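(* Let $t\ge 1$ be an integer, and let $G$ be an Eulerian digraph on $n\ge 1$ vertices with $m$ arcs. If $$m>(t-1)n,$$ then $G$ contains every oriented tree with $t$ edges; that is, for every oriented tree $T$ with $t$ edges there is an injective map $\varphi:V(T)\to V(G)$ such that $\varphi(x)\varphi(y)$ is an arc of $G$ whenever $xy$ is an arc of $T$.
   Context: A digraph is finite, has no loops and has at most one arc with any given ordered pair of endpoints; opposite arcs are allowed, so both $uv$ and $vu$ may be arcs. A digraph $G$ is Eulerian if $d_G^+(v)=d_G^-(v)$ (outdegree equals indegree) for every $v\in V(G)$; connectivity is not required. An oriented tree is any orientation of an undirected tree (each edge receives exactly one of its two directions). Copies are subgraphs, not necessarily induced. *)

theory Defs
  imports "Graph_Theory.Graph_Theory"
begin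

definition eulerian :: "('a, 'b) pre_digraph \<Rightarrow> bool" where
  "eulerian G \<longleftrightarrow> (\<forall>v \<in> verts G. out_degree G v = in_degree G v)"

text \<open>
  An undirected simple graph is represented as in the library, that is, by a symmetric digraph
  (\<^locale>\<open>graph\<close>). Each edge then yields a directed closed walk of length 2 satisfying
  \<^const>\<open>pre_digraph.cycle\<close>, so the undirected cycles are exactly those of length at least 3.
  The library's \<^const>\<open>tree\<close> cannot be used here: it only excludes directed cycles, so no
  symmetric digraph with an edge satisfies it, whereas a transitive triangle does.
  \<^const>\<open>connected\<close> includes that the vertex set is nonempty.
\<close>

definition undirected_tree :: "('a, 'b) pre_digraph \<Rightarrow> bool" where
  "undirected_tree U \<longleftrightarrow>
     graph U \<and> connected U \<and> \<not> (\<exists>p. pre_digraph.cycle U p \<and> length p \<ge> 3)"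

definition orientation_of :: "('a, 'b) pre_digraph \<Rightarrow> ('a, 'c) pre_digraph \<Rightarrow> bool" where
  "orientation_of T U \<longleftrightarrow>
     digraph T \<and> verts T = verts U \<and> arcs_ends T \<subseteq> arcs_ends U \<and>
     (\<forall>u v. u \<rightarrow>\<^bsub>U\<^esub> v \<longrightarrow> (u \<rightarrow>\<^bsub>T\<^esub> v) \<noteq> (v \<rightarrow>\<^bsub>T\<^esub> u))"

text \<open>
  A graph without parallel edges can be represented with vertex pairs as arcs, so restricting
  the underlying tree to \<^typ>\<open>'a pair_pre_digraph\<close> loses no generality.
\<close>

definition oriented_tree :: "('a, 'b) pre_digraph \<Rightarrow> bool" where
  "oriented_tree T \<longleftrightarrow>
     (\<exists>U :: 'a pair_pre_digraph.
        undirected_tree (with_proj U) \<and> orientation_of T (with_proj U))"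

definition contains_copy :: "('a, 'b) pre_digraph \<Rightarrow> ('c, 'd) pre_digraph \<Rightarrow> bool" where
  "contains_copy G T \<longleftrightarrow>
     (\<exists>\<phi>. inj_on \<phi> (verts T) \<and> \<phi> ` verts T \<subseteq> verts G \<and>
          (\<forall>x y. x \<rightarrow>\<^bsub>T\<^esub> y \<longrightarrow> \<phi> x \<rightarrow>\<^bsub>G\<^esub> \<phi> y))"

end

theory Submission
  imports Defs Complex_Main
begin

text \<open>
  The tree vertices \<open>0, \<dots>, t\<close> are placed one after the other by a random process in discrete time.
  It starts at a random arc (all arcs have mass 1) with a budget of \<open>N\<close> time units. To place vertex \<open>k\<close>,
  the admissible neighbours of the image of its parent are watched simultaneously; each of them rings
  at a random time, the first one to ring becomes the image of \<open>k\<close>, and the time spent is subtracted from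
  the budget. For every edge \<open>e\<close> that has been placed, weights \<open>\<rho> e z\<close> are maintained such that, as seen
  from \<open>e\<close>, the unused vertices \<open>z\<close> behave as if they had independent uniform ringing times that
  nobody has observed yet, and such that every position of \<open>e\<close> has mass at most 1. This is where the
  Eulerian condition enters: a bijection between the in- and the out-neighbours of a vertex transports
  this property from an old edge at the parent of \<open>k\<close> to the edge that is being placed. It follows that a
  vertex of degree \<open>D\<close> accounts in each round for a waiting time of at most
  \<open>D \<Sum>r<N. (1 - r/N)^(D-1) \<le> N + D\<close>, so that a round consumes at most \<open>nN + O(1)\<close> of the total budget. Initially
  this budget is \<open>mN\<close>, so \<open>m > (t-1)n\<close> leaves a positive budget after \<open>t - 1\<close> rounds if \<open>N\<close> is large, and any
  state carrying it is an embedding.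
\<close>

section \<open>Telescoping products\<close>

text \<open>Expand the product of the \<open>d z + \<delta> z\<close>: the left side collects the
  terms with exactly one factor \<open>\<delta>\<close>, and the terms with more of them are
  nonnegative.\<close>

lemma sum_prod_remove_le:
  fixes d \<delta> :: "'a \<Rightarrow> real"
  assumes "finite S" "\<And>z. z \<in> S \<Longrightarrow> 0 \<le> d z" "\<And>z. z \<in> S \<Longrightarrow> 0 \<le> \<delta> z"
  shows "(\<Sum>z\<in>S. \<delta> z * (\<Prod>b\<in>S - {z}. d b)) \<le> (\<Prod>z\<in>S. d z + \<delta> z) - (\<Prod>z\<in>S. d z)"
  using assms
proof (induction S rule: finite_induct)
  case empty
  then show ?case by simp
next
  case (insert x F)
  have IH: "(\<Sum>z\<in>F. \<delta> z * (\<Prod>b\<in>F - {z}. d b)) \<le> (\<Prod>z\<in>F. d z + \<delta> z) - (\<Prod>z\<in>F. d z)"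
    using insert by auto
  have "(\<Sum>z\<in>F. \<delta> z * (\<Prod>b\<in>insert x F - {z}. d b)) = (\<Sum>z\<in>F. d x * (\<delta> z * (\<Prod>b\<in>F - {z}. d b)))"
  proof (rule sum.cong[OF refl])
    fix z assume "z \<in> F"
    then have "insert x F - {z} = insert x (F - {z})" using insert.hyps by auto
    then show "\<delta> z * (\<Prod>b\<in>insert x F - {z}. d b) = d x * (\<delta> z * (\<Prod>b\<in>F - {z}. d b))"
      using insert.hyps by simp
  qed
  also have "\<dots> = d x * (\<Sum>z\<in>F. \<delta> z * (\<Prod>b\<in>F - {z}. d b))"
    by (simp add: sum_distrib_left)
  also have "\<dots> \<le> d x * ((\<Prod>z\<in>F. d z + \<delta> z) - (\<Prod>z\<in>F. d z))"
    using IH insert.prems by (intro mult_left_mono) auto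
  finally have *: "(\<Sum>z\<in>F. \<delta> z * (\<Prod>b\<in>insert x F - {z}. d b)) \<le> \<dots>" .
  have "(\<Prod>z\<in>F. d z) \<le> (\<Prod>z\<in>F. d z + \<delta> z)"
    by (rule prod_mono) (use insert.prems in auto)
  then have "\<delta> x * (\<Prod>z\<in>F. d z) \<le> \<delta> x * (\<Prod>z\<in>F. d z + \<delta> z)"
    using insert.prems by (intro mult_left_mono) auto
  moreover have "insert x F - {x} = F" using insert.hyps by auto
  ultimately show ?case
    using * insert.hyps by (simp add: algebra_simps)
qed

text \<open>Every factor drops by \<open>\<delta>\<close> in each step, so by
  \<open>sum_prod_remove_le\<close> the inner sum is at most the product at \<open>r - 1\<close>
  minus the product at \<open>r\<close>. With survival functions for \<open>f\<close>, this bounds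
  the chance that some \<open>z\<close> rings while all others outlast it.\<close>

lemma telescoping_product_le:
  fixes f :: "nat \<Rightarrow> 'a \<Rightarrow> real"
  assumes "finite S"
    and nn: "\<And>r z. r \<le> n \<Longrightarrow> z \<in> S \<Longrightarrow> 0 \<le> f r z"
    and dec: "\<And>r z. r < n \<Longrightarrow> z \<in> S \<Longrightarrow> f r z = f (Suc r) z + \<delta> z"
    and "\<And>z. z \<in> S \<Longrightarrow> 0 \<le> \<delta> z"
  shows "(\<Sum>r = 1..n. \<Sum>z\<in>S. \<delta> z * (\<Prod>b\<in>S - {z}. f r b)) \<le> (\<Prod>z\<in>S. f 0 z)"
proof -
  have "(\<Sum>r = 1..m. \<Sum>z\<in>S. \<delta> z * (\<Prod>b\<in>S - {z}. f r b)) \<le> (\<Prod>z\<in>S. f 0 z) - (\<Prod>z\<in>S. f m z)"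
    if "m \<le> n" for m
    using that
  proof (induction m)
    case (Suc m)
    have "(\<Sum>z\<in>S. \<delta> z * (\<Prod>b\<in>S - {z}. f (Suc m) b)) \<le>
        (\<Prod>z\<in>S. f (Suc m) z + \<delta> z) - (\<Prod>z\<in>S. f (Suc m) z)"
      using Suc.prems assms by (intro sum_prod_remove_le) auto
    also have "(\<Prod>z\<in>S. f (Suc m) z + \<delta> z) = (\<Prod>z\<in>S. f m z)"
      using Suc.prems by (intro prod.cong) (auto simp: dec)
    finally show ?case using Suc by simp
  qed simp
  from this[of n] show ?thesis
    using prod_nonneg[of S "f n"] nn by fastforce
qed

text \<open>\<open>A - B\<close> and \<open>B - A\<close> are equally large, so a bijection between
  them extends by the identity.\<close>

lemma bij_betw_fixing_Int:
  assumes "finite A" "finite B" "card A = card B"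
  shows "\<exists>f. bij_betw f A B \<and> (\<forall>z\<in>A \<inter> B. f z = z)"
proof -
  have "card (A - B) = card (B - A)"
    using assms by (simp add: card_Diff_subset_Int Int_commute)
  then obtain g where g: "bij_betw g (A - B) (B - A)"
    using assms finite_same_card_bij[of "A - B" "B - A"] by auto
  let ?f = "\<lambda>z. if z \<in> A - B then g z else z"
  have "bij_betw ?f (A - B) (B - A)"
    using g by (rule bij_betw_cong[THEN iffD1, rotated]) auto
  moreover have "bij_betw ?f (A \<inter> B) (A \<inter> B)"
    by (auto simp: bij_betw_def inj_on_def)
  ultimately have "bij_betw ?f ((A - B) \<union> (A \<inter> B)) ((B - A) \<union> (A \<inter> B))"
    by (rule bij_betw_combine) auto
  moreover have "(A - B) \<union> (A \<inter> B) = A" "(B - A) \<union> (A \<inter> B) = B" by auto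
  ultimately show ?thesis by (intro exI[of _ ?f]) auto
qed

text \<open>Discrete form of the fact that D(1-x)^(D-1) has integral 1 over [0,1]. Telescoping with
  \<open>D\<close> equal factors bounds the terms with \<open>r \<ge> 1\<close> by \<open>N\<close>;
  the term \<open>r = 0\<close> adds \<open>D\<close>.\<close>

lemma sum_power_ramp_le:
  fixes N :: nat
  assumes "0 < N"
  shows "D * (\<Sum>r<N. (1 - real r / N) ^ (D - 1)) \<le> real (N + D)"
proof (cases "D = 0")
  case False
  have "(\<Sum>r = 1..N. \<Sum>z\<in>{..<D}. 1 / real N * (\<Prod>b\<in>{..<D} - {z}. 1 - real r / N)) \<le> (\<Prod>z\<in>{..<D}. 1 - real 0 / N)"
    by (rule telescoping_product_le) (use assms in \<open>auto simp: add_divide_distrib divide_le_eq_1\<close>)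
  then have "(\<Sum>r = 1..N. D * (1 - real r / N) ^ (D - 1)) \<le> N"
    using assms by (simp add: sum_divide_distrib[symmetric] field_simps)
  moreover have "(\<Sum>r\<in>{1..<N}. D * (1 - real r / N) ^ (D - 1)) \<le> (\<Sum>r = 1..N. D * (1 - real r / N) ^ (D - 1))"
    by (rule sum_mono2) auto
  moreover have "(\<Sum>r<N. D * (1 - real r / N) ^ (D - 1)) = D + (\<Sum>r\<in>{1..<N}. D * (1 - real r / N) ^ (D - 1))"
    using sum.atLeast_Suc_lessThan[OF assms, of "\<lambda>r. D * (1 - real r / N) ^ (D - 1)"]
    by (simp add: lessThan_atLeast0)
  ultimately show ?thesis by (simp add: sum_distrib_left)
qed simp

text \<open>Exchange the factors one at a time: each exchange costs one difference times a mixed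
  product, which is at most the product of the remaining \<open>e\<close>. It serves as a union
  bound in \<open>budget_le\<close>.\<close>

lemma prod_diff_le_sum:
  fixes d e :: "'a \<Rightarrow> real"
  assumes "finite S" "\<And>z. z \<in> S \<Longrightarrow> 0 \<le> d z \<and> d z \<le> e z"
  shows "(\<Prod>z\<in>S. e z) - (\<Prod>z\<in>S. d z) \<le> (\<Sum>z\<in>S. (e z - d z) * (\<Prod>b\<in>S - {z}. e b))"
  using assms
proof (induction S rule: finite_induct)
  case (insert x F)
  have IH: "(\<Prod>z\<in>F. e z) - (\<Prod>z\<in>F. d z) \<le> (\<Sum>z\<in>F. (e z - d z) * (\<Prod>b\<in>F - {z}. e b))"
    using insert by auto
  have x: "0 \<le> d x" "d x \<le> e x" using insert.prems by auto
  have "(\<Sum>z\<in>F. (e z - d z) * (\<Prod>b\<in>insert x F - {z}. e b)) = e x * (\<Sum>z\<in>F. (e z - d z) * (\<Prod>b\<in>F - {z}. e b))"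
    unfolding sum_distrib_left
  proof (rule sum.cong[OF refl])
    fix z assume "z \<in> F"
    then have "insert x F - {z} = insert x (F - {z})" using insert.hyps by auto
    then show "(e z - d z) * (\<Prod>b\<in>insert x F - {z}. e b) = e x * ((e z - d z) * (\<Prod>b\<in>F - {z}. e b))"
      using insert.hyps by simp
  qed
  moreover have "e x * ((\<Prod>z\<in>F. e z) - (\<Prod>z\<in>F. d z)) \<le> e x * (\<Sum>z\<in>F. (e z - d z) * (\<Prod>b\<in>F - {z}. e b))"
    using IH x by (intro mult_left_mono) auto
  moreover have "(\<Prod>z\<in>F. d z) \<le> (\<Prod>z\<in>F. e z)" by (rule prod_mono) (use insert.prems in auto)
  then have "(e x - d x) * (\<Prod>z\<in>F. d z) \<le> (e x - d x) * (\<Prod>z\<in>F. e z)"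
    using x by (intro mult_left_mono) auto
  moreover have "insert x F - {x} = F" using insert.hyps by auto
  ultimately show ?case
    using insert.hyps by (simp add: algebra_simps)
qed simp

section \<open>The scanning process\<close>

type_synonym 'a state = "(nat \<Rightarrow> 'a) \<times> (nat \<Rightarrow> 'a \<Rightarrow> real) \<times> nat"

text \<open>
  The tree has the vertices \<open>0, \<dots>, t\<close>, and its edge \<open>k \<ge> 1\<close> joins \<open>par k\<close> to \<open>k\<close>, directed away from the root
  if and only if \<open>dir k\<close>. A state consists of the placement \<open>\<phi>\<close>, the weights \<open>\<rho>\<close> and the remaining budget.
\<close>

locale scanning =
  fixes V :: "'a set" and E :: "'a \<Rightarrow> 'a \<Rightarrow> bool"
    and par :: "nat \<Rightarrow> nat" and dir :: "nat \<Rightarrow> bool" and N :: nat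
  assumes finV: "finite V"
    and E_V: "E u v \<Longrightarrow> u \<in> V \<and> v \<in> V"
    and irrefl: "\<not> E v v"
    and balanced: "card {u. E v u} = card {u. E u v}"
    and par_less: "0 < k \<Longrightarrow> par k < k"
    and N_pos: "0 < N"
begin

section \<open>Neighbourhoods, states and transitions of the process\<close>

definition nb :: "bool \<Rightarrow> 'a \<Rightarrow> 'a set" where
  "nb d v = (if d then {u. E v u} else {u. E u v})"

text \<open>The matching that the Eulerian condition provides. As common neighbours are fixed,
  excluding the twin of a vertex also excludes the vertex itself if it lies on both sides, and the
  new image \<open>w\<close> is never in \<open>moved\<close>.\<close>

definition twin :: "bool \<Rightarrow> bool \<Rightarrow> 'a \<Rightarrow> 'a \<Rightarrow> 'a" where
  "twin d d' v = (SOME f. bij_betw f (nb d v) (nb d' v) \<and> (\<forall>z\<in>nb d v \<inter> nb d' v. f z = z))"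

text \<open>
  \<open>ref p\<close> is an edge at the tree vertex \<open>p\<close> that is placed before all children of \<open>p\<close> (except for the vertex 1
  itself), \<open>oth p\<close> is its other end, and \<open>rdir p\<close> is its direction as seen from \<open>p\<close>.
\<close>

definition ref :: "nat \<Rightarrow> nat" where "ref p = (if p = 0 then 1 else p)"
definition oth :: "nat \<Rightarrow> nat" where "oth p = (if p = 0 then 1 else par p)"
definition rdir :: "nat \<Rightarrow> bool" where "rdir p = (if p = 0 then dir 1 else \<not> dir p)"

definition tw :: "nat \<Rightarrow> (nat \<Rightarrow> 'a) \<Rightarrow> 'a \<Rightarrow> 'a" where
  "tw k \<phi> = twin (rdir (par k)) (dir k) (\<phi> (par k))"

text \<open>The twin of the other end of the reference edge is left out to balance sizes:
  \<open>moved\<close> is then as large as the set of candidates other than \<open>w\<close> before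
  the used vertices are removed.\<close>

definition scan :: "nat \<Rightarrow> (nat \<Rightarrow> 'a) \<Rightarrow> 'a set" where
  "scan k \<phi> = nb (dir k) (\<phi> (par k)) - {tw k \<phi> (\<phi> (oth (par k)))} - \<phi> ` {..<k}"

text \<open>Seen from the reference edge, \<open>b\<close> rings at a uniform time within
  \<open>N * \<rho>\<close> units; this is the chance that the first \<open>r\<close> pass
  silently.\<close>

definition surv :: "nat \<Rightarrow> (nat \<Rightarrow> 'a \<Rightarrow> real) \<Rightarrow> nat \<Rightarrow> 'a \<Rightarrow> real" where
  "surv k \<rho> r b = 1 - real r / (real N * \<rho> (ref (par k)) b)"

text \<open>
  If \<open>w\<close> rings at time \<open>r\<close>, the weights of the other watched vertices drop by their survival probability.
  The new edge inherits the weights of the reference edge, but from its point of view the vertices that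
  have been watched in vain are those of \<open>moved\<close>, the preimages under the twin map of the vertices that
  really were; hence the correction by \<open>1 - r / N\<close>.
\<close>

definition moved :: "nat \<Rightarrow> (nat \<Rightarrow> 'a) \<Rightarrow> 'a \<Rightarrow> 'a set" where
  "moved k \<phi> w = {a \<in> nb (rdir (par k)) (\<phi> (par k)). a \<noteq> \<phi> (oth (par k)) \<and> tw k \<phi> a \<noteq> w}"

definition upd :: "nat \<Rightarrow> (nat \<Rightarrow> 'a) \<Rightarrow> (nat \<Rightarrow> 'a \<Rightarrow> real) \<Rightarrow> nat \<Rightarrow> 'a \<Rightarrow> nat \<Rightarrow> 'a \<Rightarrow> real" where
  "upd k \<phi> \<rho> r w e z =
    (if z \<in> scan k \<phi> - {w} then surv k \<rho> r z else 1) *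
    (if e = k then \<rho> (ref (par k)) z * (if z \<in> moved k \<phi> w then 1 - real r / real N else 1)
        / (if z \<in> scan k \<phi> - {w} then 1 - real r / real N else 1)
     else \<rho> e z)"

text \<open>Expectation of \<open>F\<close> after one round: \<open>w\<close> rings at time
  \<open>r\<close> while the other watched vertices survive \<open>r\<close>. Ties are discarded and
  \<open>r < R\<close> keeps the budget positive, so from a valid state mass can only get
  lost.\<close>

fun step :: "nat \<Rightarrow> ('a state \<Rightarrow> real) \<Rightarrow> 'a state \<Rightarrow> real" where
  "step k F (\<phi>, \<rho>, R) = (\<Sum>w\<in>scan k \<phi>. \<Sum>r\<in>{1..<R}.
     1 / (real N * \<rho> (ref (par k)) w) * (\<Prod>b\<in>scan k \<phi> - {w}. surv k \<rho> r b) *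
     F (\<phi>(k := w), upd k \<phi> \<rho> r w, R - r))"

definition arcs1 :: "('a \<times> 'a) set" where
  "arcs1 = {(a, b). b \<in> nb (dir 1) a}"

text \<open>
  In a state contributing to \<open>mass i\<close>, the vertices \<open>0, \<dots>, i + 1\<close> have been placed.
\<close>

fun mass :: "nat \<Rightarrow> ('a state \<Rightarrow> real) \<Rightarrow> real" where
  "mass 0 F = (\<Sum>(a, b)\<in>arcs1. F (\<lambda>i. if i = 0 then a else b, \<lambda>_ _. 1, N))"
| "mass (Suc i) F = mass i (step (i + 2) F)"

text \<open>By the last clause the remaining budget fits into the ringing range of every vertex, as
  seen from every placed edge. This keeps the survival factors up to time \<open>R\<close>
  nonnegative.\<close>

fun valid :: "nat \<Rightarrow> 'a state \<Rightarrow> bool" where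
  "valid k (\<phi>, \<rho>, R) \<longleftrightarrow> inj_on \<phi> {..<k} \<and> \<phi> ` {..<k} \<subseteq> V \<and>
     (\<forall>j\<in>{1..<k}. \<phi> j \<in> nb (dir j) (\<phi> (par j))) \<and> 1 \<le> R \<and> R \<le> N \<and>
     (\<forall>e\<in>{1..<k}. \<forall>z\<in>V. real R \<le> real N * \<rho> e z)"

section \<open>Neighbourhood facts and preservation of validity\<close>

lemma nb_subset: "nb d v \<subseteq> V" using E_V by (auto simp: nb_def)
lemma finite_nb [simp]: "finite (nb d v)" using finite_subset[OF nb_subset finV] .
lemma nb_irrefl [simp]: "v \<notin> nb d v" using irrefl by (auto simp: nb_def)
lemma card_nb: "card (nb d v) = card (nb d' v)" using balanced by (auto simp: nb_def)
lemma nb_sym: "u \<in> nb d v \<longleftrightarrow> v \<in> nb (\<not> d) u" by (auto simp: nb_def)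
lemma nb_V: "u \<in> nb d v \<Longrightarrow> u \<in> V \<and> v \<in> V" using E_V by (auto simp: nb_def split: if_splits)

lemma twin: "bij_betw (twin d d' v) (nb d v) (nb d' v)"
    "z \<in> nb d v \<Longrightarrow> z \<in> nb d' v \<Longrightarrow> twin d d' v z = z"
proof -
  have "\<exists>f. bij_betw f (nb d v) (nb d' v) \<and> (\<forall>z\<in>nb d v \<inter> nb d' v. f z = z)"
    by (rule bij_betw_fixing_Int) (auto intro: card_nb)
  from someI_ex[OF this]
  show "bij_betw (twin d d' v) (nb d v) (nb d' v)" "z \<in> nb d v \<Longrightarrow> z \<in> nb d' v \<Longrightarrow> twin d d' v z = z"
    unfolding twin_def by auto
qed

lemma scan_subset: "scan k \<phi> \<subseteq> V" using nb_subset by (auto simp: scan_def)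
lemma finite_scan [simp]: "finite (scan k \<phi>)" by (auto simp: scan_def)

lemma ref_bounds: "2 \<le> k \<Longrightarrow> ref (par k) \<in> {1..<k}"
  using par_less[of k] by (auto simp: ref_def)

lemma oth_less: "2 \<le> k \<Longrightarrow> oth (par k) < k"
  using par_less[of k] par_less[of "par k"] by (auto simp: oth_def)

lemma valid_oth:
  assumes "valid k (\<phi>, \<rho>, R)" "2 \<le> k"
  shows "\<phi> (oth (par k)) \<in> nb (rdir (par k)) (\<phi> (par k))"
proof (cases "par k = 0")
  case True
  moreover have "1 \<in> {1..<k}" "par 1 = 0" using assms par_less[of 1] by auto
  moreover have "\<forall>j\<in>{1..<k}. \<phi> j \<in> nb (dir j) (\<phi> (par j))" using assms by simp
  ultimately have "\<phi> 1 \<in> nb (dir 1) (\<phi> 0)" by fastforce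
  then show ?thesis using True by (simp add: oth_def rdir_def)
next
  case False
  then have "\<phi> (par k) \<in> nb (dir (par k)) (\<phi> (par (par k)))"
    using assms par_less[of k] by auto
  then show ?thesis using False by (simp add: oth_def rdir_def nb_sym[symmetric] nb_sym[of _ "\<not> _"])
qed

lemma surv_bounds:
  assumes "valid k (\<phi>, \<rho>, R)" "2 \<le> k" "r \<le> R" "z \<in> V"
  shows "1 - r / R \<le> surv k \<rho> r z" "surv k \<rho> r z \<le> 1" "0 < \<rho> (ref (par k)) z"
proof -
  have *: "R \<le> N * \<rho> (ref (par k)) z" "1 \<le> R"
    using assms ref_bounds[of k] by auto
  then have pos: "0 < N * \<rho> (ref (par k)) z" by linarith
  then show "0 < \<rho> (ref (par k)) z" using N_pos by (simp add: zero_less_mult_iff)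
  then show "1 - r / R \<le> surv k \<rho> r z" "surv k \<rho> r z \<le> 1"
    using * divide_left_mono[of "real R" "real N * \<rho> (ref (par k)) z" "real r"]
    by (auto simp: surv_def mult_pos_pos)
qed

lemma valid_step:
  assumes val: "valid k (\<phi>, \<rho>, R)" and k: "2 \<le> k" and w: "w \<in> scan k \<phi>" and r: "r \<in> {1..<R}"
  shows "valid (Suc k) (\<phi>(k := w), upd k \<phi> \<rho> r w, R - r)"
proof -
  let ?\<phi> = "\<phi>(k := w)"
  have w': "w \<in> V" "w \<notin> \<phi> ` {..<k}" "w \<in> nb (dir k) (\<phi> (par k))"
    using w scan_subset by (auto simp: scan_def)
  have inj: "inj_on \<phi> {..<k}" and sub: "\<phi> ` {..<k} \<subseteq> V" and RN: "1 \<le> R" "R \<le> N" using val by auto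
  have img: "?\<phi> ` {..<k} = \<phi> ` {..<k}" by auto
  have "inj_on ?\<phi> (insert k {..<k})"
    using inj w'(2) by (auto simp: inj_on_def)
  then have 1: "inj_on ?\<phi> {..<Suc k}" by (simp add: lessThan_Suc)
  have 2: "?\<phi> ` {..<Suc k} \<subseteq> V" using sub w'(1) by (auto simp: less_Suc_eq)
  have 3: "?\<phi> j \<in> nb (dir j) (?\<phi> (par j))" if "j \<in> {1..<Suc k}" for j
  proof -
    have "par j < j" using that par_less by auto
    then show ?thesis using that w'(3) val by (cases "j = k") auto
  qed
  \<comment> \<open>Each weight changes by a factor of at least \<open>1 - r / R\<close>, which
    suffices because \<open>R * (1 - r / R) = R - r\<close>. For the new edge, dividing by
    \<open>c \<le> 1\<close> only helps.\<close>
  have 4: "real (R - r) \<le> N * upd k \<phi> \<rho> r w e z" if e: "e \<in> {1..<Suc k}" and z: "z \<in> V" for e z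
  proof -
    define s where "s = surv k \<rho> r z"
    define c where "c = 1 - real r / N"
    have s: "1 - r / R \<le> s" "s \<le> 1" unfolding s_def using surv_bounds[OF val k _ z, of r] r by auto
    have q: "0 < 1 - real r / R" using r by auto
    have c: "1 - r / R \<le> c" "c \<le> 1" "0 < c"
    proof -
      have "real r / N \<le> real r / R" using RN r by (intro divide_left_mono) auto
      then show "1 - r / R \<le> c" by (simp add: c_def)
      then show "0 < c" using q by linarith
    qed (simp add: c_def)
    have base: "real (R - r) \<le> N * (\<rho> e' z * x)" if "1 - r / R \<le> x" "e' \<in> {1..<k}" for e' x
    proof -
      have "real (R - r) = R * (1 - r / R)" using r by (simp add: field_simps of_nat_diff)
      also have "\<dots> \<le> (N * \<rho> e' z) * x"
      proof (rule mult_mono)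
        show "real R \<le> N * \<rho> e' z" using that val z by auto
        then show "0 \<le> N * \<rho> e' z" by (rule order_trans[rotated]) simp
      qed (use that q in auto)
      finally show ?thesis by (simp add: mult.assoc)
    qed
    show ?thesis
    proof (cases "e = k")
      case False
      then have "e \<in> {1..<k}" using e by auto
      then show ?thesis using False s c q base[of s e] base[of 1 e]
        by (auto simp: upd_def s_def[symmetric] mult.commute)
    next
      case True
      define x where "x = (if z \<in> scan k \<phi> - {w} then s else 1) * (if z \<in> moved k \<phi> w then c else 1)
        / (if z \<in> scan k \<phi> - {w} then c else 1)"
      have "s \<le> s / c" using c s q by (simp add: field_simps mult_left_le)
      then have "1 - r / R \<le> x" using s c q by (auto simp: x_def)
      moreover have "upd k \<phi> \<rho> r w e z = \<rho> (ref (par k)) z * x"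
        using True by (simp add: upd_def x_def s_def[symmetric] c_def[symmetric])
      ultimately show ?thesis using base[of x "ref (par k)"] ref_bounds[OF k] by simp
    qed
  qed
  show ?thesis using 1 2 3 4 r RN by auto
qed

lemma finite_arcs1 [simp]: "finite arcs1"
  by (rule finite_subset[of _ "V \<times> V"]) (use finV nb_V in \<open>auto simp: arcs1_def\<close>)

lemma valid_start:
  assumes "(a, b) \<in> arcs1"
  shows "valid 2 (\<lambda>i. if i = 0 then a else b, \<lambda>_ _. 1, N)"
proof -
  have *: "b \<in> nb (dir 1) a" "a \<noteq> b" "a \<in> V" "b \<in> V" using assms nb_V nb_irrefl by (auto simp: arcs1_def)
  have "{..<2::nat} = {0, 1}" "{1..<2::nat} = {1}" by auto
  then show ?thesis using * par_less[of 1] N_pos by auto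
qed

section \<open>Monotonicity and linearity of the mass functional\<close>

lemma step_mono:
  assumes "valid k x" "2 \<le> k" "\<And>y. valid (Suc k) y \<Longrightarrow> F y \<le> G y"
  shows "step k F x \<le> step k G x"
proof -
  obtain \<phi> \<rho> R where x: "x = (\<phi>, \<rho>, R)" by (cases x)
  have v: "valid k (\<phi>, \<rho>, R)" using assms x by simp
  have pos: "0 \<le> surv k \<rho> r b" if "r \<in> {1..<R}" "b \<in> V" for r b
  proof -
    have "0 \<le> 1 - real r / R" using that by auto
    then show ?thesis using order_trans[OF _ surv_bounds(1)[OF v assms(2) _ that(2)]] that(1) by simp
  qed
  have "1 / (real N * \<rho> (ref (par k)) w) * (\<Prod>b\<in>scan k \<phi> - {w}. surv k \<rho> r b) * F (\<phi>(k := w), upd k \<phi> \<rho> r w, R - r)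
     \<le> 1 / (real N * \<rho> (ref (par k)) w) * (\<Prod>b\<in>scan k \<phi> - {w}. surv k \<rho> r b) * G (\<phi>(k := w), upd k \<phi> \<rho> r w, R - r)"
    if "w \<in> scan k \<phi>" "r \<in> {1..<R}" for w r
  proof (intro mult_left_mono assms(3) valid_step v assms(2) that mult_nonneg_nonneg prod_nonneg ballI pos)
    show "0 \<le> 1 / (real N * \<rho> (ref (par k)) w)"
      using surv_bounds(3)[OF v assms(2), of 0 w] subsetD[OF scan_subset that(1)] by (simp add: less_imp_le)
  qed (use that scan_subset in auto)
  then show ?thesis unfolding x by (auto intro!: sum_mono)
qed

text \<open>Comparing on valid states is enough, since the process starts in them and stays in them;
  only there are the coefficients of \<open>step\<close> known to be nonnegative.\<close>

lemma mass_mono: "(\<And>x. valid (i + 2) x \<Longrightarrow> F x \<le> G x) \<Longrightarrow> mass i F \<le> mass i G"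
proof (induction i arbitrary: F G)
  case 0
  then show ?case using valid_start by (auto intro!: sum_mono simp: numeral_2_eq_2)
next
  case (Suc i)
  show ?case unfolding mass.simps
    by (rule Suc.IH, rule step_mono) (use Suc.prems in auto)
qed

lemma step_add: "step k (\<lambda>x. F x + G x) = (\<lambda>x. step k F x + step k G x)"
  by (auto simp: fun_eq_iff distrib_left sum.distrib)

lemma mass_add: "mass i (\<lambda>x. F x + G x) = mass i F + mass i G"
  by (induction i arbitrary: F G) (auto simp: sum.distrib step_add split_beta)

lemma step_cmult: "step k (\<lambda>x. c * F x) = (\<lambda>x. c * step k F x)"
  by (auto simp: fun_eq_iff sum_distrib_left mult_ac)

lemma mass_cmult: "mass i (\<lambda>x. c * F x) = c * mass i F"
  by (induction i arbitrary: F) (auto simp: sum_distrib_left step_cmult split_beta)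

lemma mass_sum: "finite J \<Longrightarrow> mass i (\<lambda>x. \<Sum>j\<in>J. F j x) = (\<Sum>j\<in>J. mass i (F j))"
  by (induction J rule: finite_induct) (auto simp: mass_add mass_cmult[where c = 0 and F = "\<lambda>_. 0", simplified])

section \<open>Test functions and their behaviour in a round\<close>

text \<open>
  Seen from \<open>e\<close>, each unused vertex \<open>z\<close> contributes the density \<open>1 / \<rho> e z\<close> of ringing (\<open>z \<in> U\<close>) or the
  probability \<open>1 - \<beta> z / \<rho> e z\<close> of not ringing for another \<open>N * \<beta> z\<close> time units (\<open>z \<notin> U\<close>); the budget has to
  suffice for all these times, which are at most \<open>l\<close>.
\<close>

fun test :: "nat \<Rightarrow> nat \<Rightarrow> 'a \<Rightarrow> 'a \<Rightarrow> 'a set \<Rightarrow> ('a \<Rightarrow> real) \<Rightarrow> nat \<Rightarrow> 'a state \<Rightarrow> real" where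
  "test k e a b U \<beta> l (\<phi>, \<rho>, R) =
     (if \<phi> (par e) = a \<and> \<phi> e = b \<and> U \<inter> \<phi> ` {..<k} = {} \<and> l \<le> R
      then \<Prod>z\<in>V - \<phi> ` {..<k}. if z \<in> U then 1 / \<rho> e z else 1 - \<beta> z / \<rho> e z else 0)"

definition admissible :: "('a \<Rightarrow> real) \<Rightarrow> nat \<Rightarrow> bool" where
  "admissible \<beta> l \<longleftrightarrow> l \<le> N \<and> (\<forall>z. 0 \<le> \<beta> z \<and> \<beta> z \<le> l / N)"

lemma admissible_div:
  assumes "valid k (\<phi>, \<rho>, R)" "e \<in> {1..<k}" "admissible \<beta> l" "z \<in> V"
  shows "0 < \<rho> e z" "\<beta> z / \<rho> e z \<le> l / R"
proof -
  have R: "1 \<le> R" "real R \<le> N * \<rho> e z" using assms by auto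
  then have "0 < N * \<rho> e z" by linarith
  then show pos: "0 < \<rho> e z" by (simp add: zero_less_mult_iff)
  have "\<beta> z / \<rho> e z \<le> (l / N) / (R / N)"
    using assms(3) R N_pos pos
    by (intro frac_le) (auto simp: admissible_def field_simps)
  also have "\<dots> = l / R" using N_pos by simp
  finally show "\<beta> z / \<rho> e z \<le> l / R" .
qed

lemma test_nonneg:
  assumes "valid k x" "e \<in> {1..<k}" "admissible \<beta> l"
  shows "0 \<le> test k e a b U \<beta> l x"
proof -
  obtain \<phi> \<rho> R where x: "x = (\<phi>, \<rho>, R)" by (cases x)
  have v: "valid k (\<phi>, \<rho>, R)" using assms x by simp
  have "0 \<le> 1 - \<beta> z / \<rho> e z" if "z \<in> V" "l \<le> R" for z
  proof -
    have "real l / R \<le> 1" using that v by auto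
    then show ?thesis using admissible_div(2)[OF v assms(2,3) that(1)] by linarith
  qed
  then show ?thesis
    using admissible_div(1)[OF v assms(2,3)] unfolding x by (auto intro!: prod_nonneg simp: less_imp_le)
qed

text \<open>A supermartingale property. The survival factor \<open>s\<close> of a vertex cancels
  against its updated weight: \<open>s * (1 - \<beta> / (\<rho> * s)) = s - \<beta> / \<rho>\<close>
  and \<open>s / (\<rho> * s) = 1 / \<rho>\<close>. What remains is a sum for
  \<open>telescoping_product_le\<close>.\<close>

lemma test_step_old:
  assumes "valid k x" and k: "2 \<le> k" and e: "e \<in> {1..<k}" and adm: "admissible \<beta> l"
  shows "step k (test (Suc k) e a b U \<beta> l) x \<le> test k e a b U \<beta> l x"
proof -
  obtain \<phi> \<rho> R where x: "x = (\<phi>, \<rho>, R)" by (cases x)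
  have v: "valid k (\<phi>, \<rho>, R)" using assms x by simp
  have e': "par e < e" "e < k" "par e < k" "par e \<noteq> k" "e \<noteq> k" using e par_less[of e] by auto
  have img: "\<phi>(k := w) ` {..<Suc k} = insert w (\<phi> ` {..<k})" for w
    by (auto simp: lessThan_Suc)
  show ?thesis
  proof (cases "\<phi> (par e) = a \<and> \<phi> e = b \<and> U \<inter> \<phi> ` {..<k} = {} \<and> l \<le> R")
    case False
    then have "test (Suc k) e a b U \<beta> l (\<phi>(k := w), upd k \<phi> \<rho> r w, R - r) = 0" for w r
      using e' img[of w] by (simp only: test.simps) auto
    then show ?thesis using test_nonneg[OF assms(1) e adm] unfolding x by simp
  next
    case True
    define S where "S = V - \<phi> ` {..<k}"
    define W where "W = scan k \<phi>"
    define f where "f r z = (if z \<in> U then 1 / \<rho> e z else (if z \<in> W then surv k \<rho> r z else 1) - \<beta> z / \<rho> e z)" for r z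
    \<comment> \<open>Zero on \<open>U\<close>: a vertex of \<open>U\<close> that rings becomes
      used, which makes \<open>test\<close> vanish.\<close>
    define \<delta> where "\<delta> z = (if z \<in> W - U then 1 / (real N * \<rho> (ref (par k)) z) else 0)" for z
    have finS: "finite S" using finV by (simp add: S_def)
    have WS: "W \<subseteq> S" using scan_subset by (auto simp: W_def S_def scan_def)
    have SV: "S \<subseteq> V" by (auto simp: S_def)
    have R: "1 \<le> R" "l \<le> R" using v True by auto
    have f_nn: "0 \<le> f r z" if "r \<le> R - l" "z \<in> S" for r z
    proof -
      have "real r / R \<le> (real R - real l) / R"
        using that R by (intro divide_right_mono) auto
      then have "real r / R + real l / R \<le> 1" using R by (simp add: diff_divide_distrib)
      moreover have "1 - real r / R \<le> surv k \<rho> r z" if "z \<in> W"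
        using surv_bounds(1)[OF v k _ , of r z] that WS SV \<open>r \<le> R - l\<close> by auto
      moreover have "\<beta> z / \<rho> e z \<le> l / R" "0 < \<rho> e z"
        using admissible_div[OF v e adm] that SV by auto
      moreover have "0 \<le> real r / R" by simp
      ultimately show ?thesis unfolding f_def by (smt (verit) divide_nonneg_pos)
    qed
    have \<delta>_nn: "0 \<le> \<delta> z" if "z \<in> S" for z
      using surv_bounds(3)[OF v k, of 0 z] that SV by (auto simp: \<delta>_def)
    have one_r: "(\<Sum>w\<in>W. 1 / (real N * \<rho> (ref (par k)) w) * (\<Prod>b\<in>W - {w}. surv k \<rho> r b) *
       test (Suc k) e a b U \<beta> l (\<phi>(k := w), upd k \<phi> \<rho> r w, R - r)) \<le>
       (if r \<le> R - l then \<Sum>z\<in>S. \<delta> z * (\<Prod>b\<in>S - {z}. f r b) else 0)" (is "?L \<le> ?R")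
      if r: "r \<in> {1..<R}" for r
    proof (cases "r \<le> R - l")
      case False
      then have "\<not> l \<le> R - r" using r R by auto
      then show ?thesis using False by simp
    next
      case r': True
      have "1 / (real N * \<rho> (ref (par k)) w) * (\<Prod>b\<in>W - {w}. surv k \<rho> r b) *
         test (Suc k) e a b U \<beta> l (\<phi>(k := w), upd k \<phi> \<rho> r w, R - r) = \<delta> w * (\<Prod>b\<in>S - {w}. f r b)"
        if w: "w \<in> W" for w
      proof (cases "w \<in> U")
        case True
        then show ?thesis using img[of w] by (simp add: \<delta>_def del: fun_upd_apply)
      next
        case False
        have "test (Suc k) e a b U \<beta> l (\<phi>(k := w), upd k \<phi> \<rho> r w, R - r) =
          (\<Prod>z\<in>S - {w}. if z \<in> U then 1 / upd k \<phi> \<rho> r w e z else 1 - \<beta> z / upd k \<phi> \<rho> r w e z)"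
        proof -
          have "V - insert w (\<phi> ` {..<k}) = S - {w}" by (auto simp: S_def)
          moreover have "l \<le> R - r" using r r' R by auto
          ultimately show ?thesis
            using True False e' img[of w] by (simp only: test.simps) auto
        qed
        moreover have "(\<Prod>b\<in>W - {w}. surv k \<rho> r b) = (\<Prod>b\<in>S - {w}. if b \<in> W then surv k \<rho> r b else 1)"
          using finS WS by (intro prod.mono_neutral_cong_left) auto
        moreover have "(\<Prod>b\<in>S - {w}. if b \<in> W then surv k \<rho> r b else 1) *
            (\<Prod>z\<in>S - {w}. if z \<in> U then 1 / upd k \<phi> \<rho> r w e z else 1 - \<beta> z / upd k \<phi> \<rho> r w e z)
            = (\<Prod>b\<in>S - {w}. f r b)"
          unfolding prod.distrib[symmetric]
        proof (rule prod.cong[OF refl])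
          fix z assume z: "z \<in> S - {w}"
          have "0 < 1 - real r / R" using r by auto
          then have "0 < surv k \<rho> r z"
            using less_le_trans[OF _ surv_bounds(1)[OF v k, of r z]] r z SV by auto
          then show "(if z \<in> W then surv k \<rho> r z else 1) *
            (if z \<in> U then 1 / upd k \<phi> \<rho> r w e z else 1 - \<beta> z / upd k \<phi> \<rho> r w e z) = f r z"
            using z e' admissible_div(1)[OF v e adm, of z] SV
            by (auto simp: f_def upd_def W_def[symmetric] field_simps)
        qed
        ultimately show ?thesis using w False by (simp add: \<delta>_def mult.assoc)
      qed
      then have "?L = (\<Sum>w\<in>W. \<delta> w * (\<Prod>b\<in>S - {w}. f r b))" by (intro sum.cong) auto
      also have "\<dots> \<le> (\<Sum>z\<in>S. \<delta> z * (\<Prod>b\<in>S - {z}. f r b))"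
        by (rule sum_mono2[OF finS WS]) (use \<delta>_nn f_nn r' in \<open>auto intro!: mult_nonneg_nonneg prod_nonneg\<close>)
      finally show ?thesis using r' by simp
    qed
    have "step k (test (Suc k) e a b U \<beta> l) x \<le> (\<Sum>r\<in>{1..<R}. if r \<le> R - l then \<Sum>z\<in>S. \<delta> z * (\<Prod>b\<in>S - {z}. f r b) else 0)"
      unfolding x step.simps W_def[symmetric]
      by (subst sum.swap) (rule sum_mono, rule one_r)
    also have "\<dots> = (\<Sum>r\<in>{1..<R} \<inter> {r. r \<le> R - l}. \<Sum>z\<in>S. \<delta> z * (\<Prod>b\<in>S - {z}. f r b))"
      by (subst sum.inter_restrict) auto
    also have "\<dots> \<le> (\<Sum>r = 1..R - l. \<Sum>z\<in>S. \<delta> z * (\<Prod>b\<in>S - {z}. f r b))"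
      by (rule sum_mono2) (use \<delta>_nn f_nn in \<open>auto intro!: sum_nonneg mult_nonneg_nonneg prod_nonneg\<close>)
    also have "\<dots> \<le> (\<Prod>z\<in>S. f 0 z)"
    proof (rule telescoping_product_le[OF finS f_nn])
      fix r z assume "r < R - l" "z \<in> S"
      show "f r z = f (Suc r) z + \<delta> z"
        using WS SV by (auto simp: f_def \<delta>_def surv_def add_divide_distrib)
    qed (use \<delta>_nn in auto)
    also have "\<dots> = test k e a b U \<beta> l x"
      using True unfolding x by (auto simp: f_def S_def surv_def intro!: prod.cong)
    finally show ?thesis .
  qed
qed

text \<open>
  Expressing \<open>test\<close> for a new edge by \<open>test\<close> for its reference edge turns \<open>\<beta>\<close> into \<open>shift\<close> and yields a factor
  \<open>gain\<close> for each vertex of \<open>U\<close>. Here \<open>F\<close> are the moved and \<open>G\<close> the watched vertices; as these sets have the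
  same size, the factors \<open>1 - r / N\<close> cancel in the product over all vertices.
\<close>

definition gain :: "nat \<Rightarrow> 'a set \<Rightarrow> 'a set \<Rightarrow> 'a \<Rightarrow> real" where
  "gain r F G z = (if z \<in> G then 1 - real r / real N else 1) / (if z \<in> F then 1 - real r / real N else 1)"

definition shift :: "nat \<Rightarrow> 'a set \<Rightarrow> 'a set \<Rightarrow> ('a \<Rightarrow> real) \<Rightarrow> 'a \<Rightarrow> real" where
  "shift r F G \<beta> z = (if z \<in> G then real r / real N else 0) + gain r F G z * \<beta> z"

text \<open>The critical case is \<open>z\<close> in \<open>F\<close> but not in \<open>G\<close>,
  where \<open>\<beta> z\<close> is divided by \<open>c = 1 - r / N\<close>. There
  \<open>l \<le> (l + r) * c\<close> amounts to \<open>0 \<le> r * (N - l - r)\<close>.\<close>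

lemma admissible_shift:
  assumes adm: "admissible \<beta> l" and r: "r < N" "l + r \<le> N"
  shows "admissible (shift r F G \<beta>) (l + r)"
proof -
  define c where "c = 1 - real r / real N"
  have c: "0 < c" "c \<le> 1" using r by (auto simp: c_def)
  have "0 \<le> shift r F G \<beta> z \<and> shift r F G \<beta> z \<le> real (l + r) / real N" for z
  proof -
    have b: "0 \<le> \<beta> z" "\<beta> z \<le> l / N" using adm by (auto simp: admissible_def)
    have 1: "\<beta> z / c \<le> (real l + real r) / N"
    proof -
      have "real l \<le> (real l + real r) * c"
      proof -
        have "0 \<le> real r * (real N - real l - real r)" using r by (intro mult_nonneg_nonneg) auto
        then show ?thesis using N_pos by (simp add: c_def field_simps)
      qed
      then have "real l / N / c \<le> (real l + real r) / N"
        using c N_pos by (simp add: field_simps)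
      moreover have "\<beta> z / c \<le> real l / N / c" using b c by (intro divide_right_mono) auto
      ultimately show ?thesis by linarith
    qed
    have 2: "c * \<beta> z \<le> l / N" using b c mult_left_le_one_le[of "\<beta> z" c] by linarith
    have 3: "\<beta> z \<le> (real l + real r) / N" "real r / N + c * \<beta> z \<le> (real l + real r) / N"
      using b 2 by (auto simp: add_divide_distrib intro: add_increasing2)
    have 4: "real r / N + \<beta> z \<le> (real l + real r) / N" using b by (simp add: add_divide_distrib)
    show ?thesis using b c 1 2 3 4 by (auto simp: shift_def gain_def c_def[symmetric])
  qed
  then show ?thesis using r by (auto simp: admissible_def)
qed

text \<open>\<open>others\<close> and \<open>targets\<close> replace \<open>moved\<close> and the
  watched set by sets that depend only on the positions \<open>v\<close>, \<open>w\<close>,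
  \<open>y\<close>, so that they can be parameters of \<open>test\<close>. \<open>others\<close>
  also contains the possible values of \<open>y\<close>.\<close>

definition others :: "nat \<Rightarrow> 'a \<Rightarrow> 'a \<Rightarrow> 'a set" where
  "others k v w = {a \<in> nb (rdir (par k)) v. twin (rdir (par k)) (dir k) v a \<noteq> w}"

definition targets :: "nat \<Rightarrow> 'a \<Rightarrow> 'a \<Rightarrow> 'a \<Rightarrow> 'a set" where
  "targets k v w y = nb (dir k) v - {twin (rdir (par k)) (dir k) v y, w}"

text \<open>The new edge lands on \<open>(v, w)\<close> only if \<open>w\<close> rings; its density
  \<open>1 / \<rho>\<close> is recorded by putting \<open>w\<close> into \<open>U\<close> for the
  reference edge, leaving \<open>1 / N\<close>. The summand of the true other end \<open>y\<close>
  carries the bound, and the others are nonnegative; summing over \<open>y\<close> frees the bound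
  from the state.\<close>

lemma test_step_new:
  assumes "valid k x" and k: "2 \<le> k" and adm: "admissible \<beta> l" and U: "U \<subseteq> V"
  shows "step k (test (Suc k) k v w U \<beta> l) x \<le>
    (\<Sum>r | r \<in> {1..<N} \<and> l + r \<le> N. \<Sum>y\<in>others k v w - U - {w}.
       1 / N * (\<Prod>z\<in>U. gain r (others k v w - {y}) (targets k v w y) z) *
       test k (ref (par k)) (if par k = 0 then v else y) (if par k = 0 then y else v) (insert w U)
         (shift r (others k v w - {y}) (targets k v w y) \<beta>) (l + r) x)"
    (is "_ \<le> (\<Sum>r | ?P r. \<Sum>y\<in>?Y. ?T r y x)")
proof -
  obtain \<phi> \<rho> R where x: "x = (\<phi>, \<rho>, R)" by (cases x)
  have val: "valid k (\<phi>, \<rho>, R)" using assms x by simp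
  have fin: "finite ?Y" "finite {r. ?P r}" by (auto simp: others_def)
  have nn: "0 \<le> ?T r y x" if "?P r" for r y
    using that gain_def
    by (intro mult_nonneg_nonneg test_nonneg[OF assms(1) ref_bounds[OF k]] admissible_shift adm prod_nonneg ballI)
       (auto simp: gain_def)
  have nn': "0 \<le> (\<Sum>r | ?P r. \<Sum>y\<in>?Y. ?T r y x)"
    using nn by (intro sum_nonneg) auto
  define y where "y = \<phi> (oth (par k))"
  have pk: "par k < k" using k par_less by simp
  have img: "\<phi>(k := w) ` {..<Suc k} = insert w (\<phi> ` {..<k})" for w
    by (auto simp: lessThan_Suc)
  show ?thesis
  proof (cases "\<phi> (par k) = v \<and> w \<in> scan k \<phi> \<and> w \<notin> U \<and> U \<inter> \<phi> ` {..<k} = {}")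
    case False
    have "step k (test (Suc k) k v w U \<beta> l) x = 0"
      unfolding x step.simps
    proof (intro sum.neutral ballI)
      fix w' r assume "w' \<in> scan k \<phi>"
      then have "test (Suc k) k v w U \<beta> l (\<phi>(k := w'), upd k \<phi> \<rho> r w', R - r) = 0"
        using False pk img[of w'] by (simp only: test.simps) auto
      then show "1 / (real N * \<rho> (ref (par k)) w') * (\<Prod>b\<in>scan k \<phi> - {w'}. surv k \<rho> r b) *
         test (Suc k) k v w U \<beta> l (\<phi>(k := w'), upd k \<phi> \<rho> r w', R - r) = 0" by simp
    qed
    then show ?thesis using nn' by simp
  next
    case True
    define S where "S = V - \<phi> ` {..<k} - {w}"
    define W where "W = scan k \<phi> - {w}"
    define F where "F = others k v w - {y}"
    define G where "G = targets k v w y"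
    have R: "1 \<le> R" "R \<le> N" using val by auto
    have WS: "W \<subseteq> S" using scan_subset by (auto simp: W_def S_def scan_def)
    have SV: "S \<subseteq> V" "finite S" using finV by (auto simp: S_def)
    have wV: "w \<in> V" using True scan_subset by auto
    have y: "y \<in> ?Y"
    proof -
      have "y \<in> nb (rdir (par k)) v" using valid_oth[OF val k] True by (simp add: y_def)
      moreover have "twin (rdir (par k)) (dir k) v y \<noteq> w"
        using True by (auto simp: scan_def tw_def y_def)
      moreover have "y \<in> \<phi> ` {..<k}" using oth_less[OF k] by (auto simp: y_def)
      moreover have "w \<notin> \<phi> ` {..<k}" using True by (auto simp: scan_def)
      ultimately show ?thesis using True by (auto simp: others_def)
    qed
    have G: "z \<in> G \<longleftrightarrow> z \<in> W" if "z \<in> S" for z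
      using that True by (auto simp: G_def targets_def W_def scan_def S_def tw_def y_def)
    have F: "z \<in> moved k \<phi> w \<longleftrightarrow> z \<in> F" for z
      using True by (auto simp: moved_def F_def others_def tw_def y_def)
    have term_le: "1 / (real N * \<rho> (ref (par k)) w) * (\<Prod>b\<in>scan k \<phi> - {w}. surv k \<rho> r b) *
       test (Suc k) k v w U \<beta> l (\<phi>(k := w), upd k \<phi> \<rho> r w, R - r) \<le> (if l + r \<le> R then ?T r y x else 0)"
      if r: "r \<in> {1..<R}" for r
    proof (cases "l + r \<le> R")
      case False
      then have "\<not> l \<le> R - r" using r by auto
      then show ?thesis using False by simp
    next
      case lr: True
      let ?\<rho> = "\<rho> (ref (par k))"
      let ?f = "\<lambda>z. if z \<in> insert w U then 1 / ?\<rho> z else 1 - shift r F G \<beta> z / ?\<rho> z"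
      have 1: "test (Suc k) k v w U \<beta> l (\<phi>(k := w), upd k \<phi> \<rho> r w, R - r) =
          (\<Prod>z\<in>S. if z \<in> U then 1 / upd k \<phi> \<rho> r w k z else 1 - \<beta> z / upd k \<phi> \<rho> r w k z)"
      proof -
        have "V - insert w (\<phi> ` {..<k}) = S" by (auto simp: S_def)
        moreover have "l \<le> R - r" using r lr by auto
        ultimately show ?thesis
          using True pk img[of w] by (simp only: test.simps) auto
      qed
      have 2: "test k (ref (par k)) (if par k = 0 then v else y) (if par k = 0 then y else v) (insert w U) (shift r F G \<beta>) (l + r) x
         = 1 / ?\<rho> w * (\<Prod>z\<in>S. ?f z)"
      proof -
        have "V - \<phi> ` {..<k} = insert w S" "w \<notin> S"
          using True scan_subset by (auto simp: S_def scan_def)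
        then have "(\<Prod>z\<in>V - \<phi> ` {..<k}. ?f z) = 1 / ?\<rho> w * (\<Prod>z\<in>S. ?f z)"
          using SV by simp
        moreover have "\<phi> (par (ref (par k))) = (if par k = 0 then v else y)" "\<phi> (ref (par k)) = (if par k = 0 then y else v)"
          using True par_less[of 1] by (auto simp: y_def ref_def oth_def)
        moreover have "insert w U \<inter> \<phi> ` {..<k} = {}" using True by (auto simp: scan_def)
        ultimately show ?thesis using lr unfolding x by (simp only: test.simps) auto
      qed
      have US: "U \<subseteq> S" using True U by (auto simp: S_def)
      have 3: "(\<Prod>b\<in>W. surv k \<rho> r b) = (\<Prod>b\<in>S. if b \<in> W then surv k \<rho> r b else 1)"
        using SV WS by (intro prod.mono_neutral_cong_left) auto
      have 4: "(\<Prod>z\<in>U. gain r F G z) = (\<Prod>z\<in>S. if z \<in> U then gain r F G z else 1)"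
        using SV US by (intro prod.mono_neutral_cong_left) auto
      \<comment> \<open>Checked vertex by vertex. Outside \<open>U\<close> the left factor is the
        survival factor minus \<open>gain * \<beta> / \<rho>\<close>; as exactly the vertices of
        \<open>G\<close> are watched, this is \<open>1 - shift / \<rho>\<close>.\<close>
      have 5: "(\<Prod>b\<in>S. if b \<in> W then surv k \<rho> r b else 1) *
          (\<Prod>z\<in>S. if z \<in> U then 1 / upd k \<phi> \<rho> r w k z else 1 - \<beta> z / upd k \<phi> \<rho> r w k z) =
          (\<Prod>z\<in>S. if z \<in> U then gain r F G z else 1) * (\<Prod>z\<in>S. ?f z)"
        unfolding prod.distrib[symmetric]
      proof (rule prod.cong[OF refl])
        fix z assume z: "z \<in> S"
        have "0 < 1 - real r / real R" using r by auto
        then have s: "0 < surv k \<rho> r z"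
          using less_le_trans[OF _ surv_bounds(1)[OF val k, of r z]] r z SV by auto
        have c: "0 < 1 - real r / real N" using r R by auto
        have p: "0 < ?\<rho> z" using surv_bounds(3)[OF val k, of 0 z] z SV by auto
        have u: "upd k \<phi> \<rho> r w k z = (if z \<in> W then surv k \<rho> r z else 1) * (?\<rho> z / gain r F G z)"
          using c by (auto simp: upd_def W_def[symmetric] F gain_def G[OF z])
        have g: "0 < gain r F G z" using c by (auto simp: gain_def)
        have zw: "z \<noteq> w" using z by (auto simp: S_def)
        show "(if z \<in> W then surv k \<rho> r z else 1) *
            (if z \<in> U then 1 / upd k \<phi> \<rho> r w k z else 1 - \<beta> z / upd k \<phi> \<rho> r w k z) =
            (if z \<in> U then gain r F G z else 1) * ?f z"
        proof (cases "z \<in> U")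
          case True
          then show ?thesis using s p g zw by (simp add: u)
        next
          case False
          have "surv k \<rho> r z = 1 - (real r / real N) / ?\<rho> z" using p by (simp add: surv_def)
          moreover have "t * (1 - \<beta> z / (t * (?\<rho> z / gain r F G z))) = t - gain r F G z * \<beta> z / ?\<rho> z"
            if "0 < t" for t
            using that p g by (simp add: field_simps)
          then have "(if z \<in> W then surv k \<rho> r z else 1) * (1 - \<beta> z / upd k \<phi> \<rho> r w k z) =
            (if z \<in> W then surv k \<rho> r z else 1) - gain r F G z * \<beta> z / ?\<rho> z"
            using s unfolding u by (cases "z \<in> W") (simp_all only: if_True if_False zero_less_one)
          ultimately show ?thesis using False zw
            by (simp add: shift_def G[OF z] add_divide_distrib)
        qed
      qed
      show ?thesis using lr True
        unfolding W_def[symmetric] F_def[symmetric] G_def[symmetric] 1 2 3 4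
        using 5 by (simp add: field_simps)
    qed
    have "step k (test (Suc k) k v w U \<beta> l) x =
      (\<Sum>w'\<in>scan k \<phi>. if w' = w then \<Sum>r\<in>{1..<R}. 1 / (real N * \<rho> (ref (par k)) w) * (\<Prod>b\<in>scan k \<phi> - {w}. surv k \<rho> r b) *
       test (Suc k) k v w U \<beta> l (\<phi>(k := w), upd k \<phi> \<rho> r w, R - r) else 0)"
      unfolding x step.simps by (rule sum.cong[OF refl]) auto
    also have "\<dots> = (\<Sum>r\<in>{1..<R}. 1 / (real N * \<rho> (ref (par k)) w) * (\<Prod>b\<in>scan k \<phi> - {w}. surv k \<rho> r b) *
       test (Suc k) k v w U \<beta> l (\<phi>(k := w), upd k \<phi> \<rho> r w, R - r))"
      using True by (subst sum.delta) auto
    also have "\<dots> \<le> (\<Sum>r\<in>{1..<R}. if l + r \<le> R then ?T r y x else 0)"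
      by (rule sum_mono, rule term_le)
    also have "\<dots> = (\<Sum>r\<in>{1..<R} \<inter> {r. l + r \<le> R}. ?T r y x)"
      by (subst sum.inter_restrict) auto
    also have "\<dots> \<le> (\<Sum>r | ?P r. ?T r y x)"
      by (rule sum_mono2) (use R nn in auto)
    also have "\<dots> \<le> (\<Sum>r | ?P r. \<Sum>y\<in>?Y. ?T r y x)"
    proof (rule sum_mono)
      fix r assume "r \<in> {r. ?P r}"
      then show "?T r y x \<le> (\<Sum>y\<in>?Y. ?T r y x)"
        using member_le_sum[of y ?Y "\<lambda>y. ?T r y x"] y nn fin by auto
    qed
    finally show ?thesis .
  qed
qed

lemma test_eq_0:
  assumes "valid k x" "e \<in> {1..<k}" "a \<in> U \<or> b \<in> U \<or> b \<notin> nb (dir e) a"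
  shows "test k e a b U \<beta> l x = 0"
proof -
  obtain \<phi> \<rho> R where x: "x = (\<phi>, \<rho>, R)" by (cases x)
  have "\<phi> e \<in> nb (dir e) (\<phi> (par e))" using assms x by simp
  moreover have "\<phi> e \<in> \<phi> ` {..<k}" "\<phi> (par e) \<in> \<phi> ` {..<k}"
    using assms par_less[of e] by auto
  ultimately show ?thesis using assms(3) by (auto simp: x)
qed

text \<open>The twin map restricts to a bijection: \<open>y\<close> goes with its twin, and the
  preimage of \<open>w\<close> is already missing from \<open>others\<close>.\<close>

lemma card_others_targets:
  assumes "y \<in> others k v w"
  shows "card (others k v w - {y}) = card (targets k v w y)"
proof -
  let ?t = "twin (rdir (par k)) (dir k) v"
  have bij: "bij_betw ?t (nb (rdir (par k)) v) (nb (dir k) v)" by (rule twin)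
  then have inj: "inj_on ?t (nb (rdir (par k)) v)" and im: "?t ` nb (rdir (par k)) v = nb (dir k) v"
    by (auto simp: bij_betw_def)
  have y: "y \<in> nb (rdir (par k)) v" using assms by (auto simp: others_def)
  have "inj_on ?t (others k v w - {y})" by (rule inj_on_subset[OF inj]) (auto simp: others_def)
  moreover have "?t ` (others k v w - {y}) = targets k v w y"
    unfolding others_def targets_def im[symmetric] using inj y by (auto dest: inj_onD)
  ultimately show ?thesis by (metis card_image)
qed

text \<open>By equality of sizes the gains multiply to 1 over \<open>S - {y}\<close>, and outside
  \<open>U\<close> one has \<open>1 - shift = gain * f\<close>. This moves the loss
  \<open>r / N\<close> from \<open>targets\<close>, which varies with \<open>y\<close>, to
  \<open>others k v w\<close>, which does not. So the sum over \<open>y\<close> telescopes as if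
  \<open>others k v w\<close> had been watched.\<close>

lemma telescoping_targets_le:
  assumes w: "w \<in> nb (dir k) v" and U: "U \<subseteq> V" "v \<notin> U" "w \<notin> U" and adm: "admissible \<beta> l"
  shows "(\<Sum>r | r \<in> {1..<N} \<and> l + r \<le> N. \<Sum>y\<in>others k v w - U - {w}.
       1 / N * (\<Prod>z\<in>U. gain r (others k v w - {y}) (targets k v w y) z) *
       (\<Prod>z\<in>V - insert w U - {v, y}. 1 - shift r (others k v w - {y}) (targets k v w y) \<beta> z))
     \<le> (\<Prod>z\<in>V - U - {v, w}. 1 - \<beta> z)"
    (is "(\<Sum>r | ?P r. \<Sum>y\<in>?Y. ?T r y) \<le> _")
proof -
  define S where "S = V - {v, w}"
  define \<delta> where "\<delta> z = (if z \<in> ?Y then 1 / real N else 0)" for z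
  define f where "f r z = (if z \<in> U then 1 else if z \<in> others k v w then 1 - real r / N - \<beta> z else 1 - \<beta> z)"
    for r z
  have S: "finite S" using finV by (simp add: S_def)
  have b: "0 \<le> \<beta> z" "\<beta> z \<le> l / N" "l \<le> N" for z using adm by (auto simp: admissible_def)
  have w_others: "w \<notin> others k v w"
    using twin(2)[of w "rdir (par k)" v "dir k"] w by (auto simp: others_def)
  have Y: "?Y \<subseteq> S" using nb_subset by (auto simp: others_def S_def)
  have f_nn: "0 \<le> f r z" if "r \<le> N - l" for r z
  proof -
    have "real r / N + real l / N \<le> 1"
      using that b(3) N_pos by (simp add: add_divide_distrib[symmetric])
    moreover have "0 \<le> real r / N" by simp
    ultimately show ?thesis using b(1,2)[of z] unfolding f_def by (smt (verit))
  qed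
  have T: "?T r y = \<delta> y * (\<Prod>z\<in>S - {y}. f r z)" if r: "?P r" and y: "y \<in> ?Y" for r y
  proof -
    define c where "c = 1 - real r / real N"
    define F where "F = others k v w - {y}"
    define G where "G = targets k v w y"
    have c: "0 < c" using r by (auto simp: c_def)
    have F: "F \<subseteq> S - {y}" using nb_subset w_others by (auto simp: F_def others_def S_def)
    have y_nb: "y \<in> nb (rdir (par k)) v" using y by (auto simp: others_def)
    have G: "G \<subseteq> S - {y}"
      using nb_subset twin(2)[OF y_nb] by (auto simp: G_def targets_def S_def)
    have yU: "U \<subseteq> S - {y}" using U y by (auto simp: S_def)
    have "card F = card G" unfolding F_def G_def by (rule card_others_targets) (use y in auto)
    have 1: "(\<Prod>z\<in>S - {y}. gain r F G z) = 1"
    proof -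
      have "(\<Prod>z\<in>S - {y}. if z \<in> G then c else 1) = c ^ card G"
        using G S by (simp add: prod.If_cases Int_absorb1)
      moreover have "(\<Prod>z\<in>S - {y}. if z \<in> F then c else 1) = c ^ card F"
        using F S by (simp add: prod.If_cases Int_absorb1)
      ultimately show ?thesis
        using c \<open>card F = card G\<close> unfolding gain_def c_def[symmetric] prod_dividef by simp
    qed
    have 2: "(\<Prod>z\<in>U. gain r F G z) = (\<Prod>z\<in>S - {y}. if z \<in> U then gain r F G z else 1)"
      using S yU by (intro prod.mono_neutral_cong_left) auto
    have 3: "(\<Prod>z\<in>V - insert w U - {v, y}. 1 - shift r F G \<beta> z) =
      (\<Prod>z\<in>S - {y}. if z \<in> U then 1 else 1 - shift r F G \<beta> z)"
      using S by (intro prod.mono_neutral_cong_left) (auto simp: S_def)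
    have "(\<Prod>z\<in>U. gain r F G z) * (\<Prod>z\<in>V - insert w U - {v, y}. 1 - shift r F G \<beta> z)
       = (\<Prod>z\<in>S - {y}. gain r F G z * f r z)"
      unfolding 2 3 prod.distrib[symmetric]
    proof (rule prod.cong[OF refl])
      fix z assume "z \<in> S - {y}"
      then have "z \<in> others k v w \<longleftrightarrow> z \<in> F" by (auto simp: F_def)
      moreover have rc: "real r / N = 1 - c" by (simp add: c_def)
      ultimately show "(if z \<in> U then gain r F G z else 1) * (if z \<in> U then 1 else 1 - shift r F G \<beta> z) =
         gain r F G z * f r z"
        using c unfolding f_def shift_def gain_def c_def[symmetric] unfolding rc
        by (auto simp: field_simps)
    qed
    also have "\<dots> = (\<Prod>z\<in>S - {y}. f r z)" by (simp add: prod.distrib 1)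
    finally show ?thesis using y by (simp add: \<delta>_def F_def G_def)
  qed
  have "(\<Sum>r | ?P r. \<Sum>y\<in>?Y. ?T r y) = (\<Sum>r | ?P r. \<Sum>y\<in>?Y. \<delta> y * (\<Prod>z\<in>S - {y}. f r z))"
    using T by (intro sum.cong) auto
  also have "\<dots> \<le> (\<Sum>r | ?P r. \<Sum>y\<in>S. \<delta> y * (\<Prod>z\<in>S - {y}. f r z))"
    by (intro sum_mono sum_mono2 S Y) (auto simp: \<delta>_def)
  also have "\<dots> \<le> (\<Sum>r = 1..N - l. \<Sum>y\<in>S. \<delta> y * (\<Prod>z\<in>S - {y}. f r z))"
    by (rule sum_mono2) (use f_nn in \<open>auto simp: \<delta>_def intro!: sum_nonneg divide_nonneg_nonneg prod_nonneg\<close>)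
  also have "\<dots> \<le> (\<Prod>z\<in>S. f 0 z)"
    by (rule telescoping_product_le[OF S f_nn]) (auto simp: f_def \<delta>_def add_divide_distrib w_others S_def)
  also have "\<dots> = (\<Prod>z\<in>V - U - {v, w}. 1 - \<beta> z)"
    using S by (intro prod.mono_neutral_cong_right) (auto simp: f_def S_def)
  finally show ?thesis .
qed

text \<open>Old edges are handled by \<open>test_step_old\<close>. A new edge is traced back to its
  reference edge by \<open>test_step_new\<close>, and \<open>telescoping_targets_le\<close> adds up
  the bounds. Tracing back enlarges \<open>U\<close> and changes \<open>\<beta>\<close>, so the
  induction needs both arbitrary; for \<open>U = {}\<close> and \<open>\<beta> = 0\<close> it bounds
  the mass of a position by 1.\<close>

lemma mass_test_le:
  assumes "e \<in> {1..i + 1}" "U \<subseteq> V" "admissible \<beta> l"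
  shows "mass i (test (i + 2) e a b U \<beta> l) \<le> (\<Prod>z\<in>V - U - {a, b}. 1 - \<beta> z)"
  using assms
proof (induction i arbitrary: e U \<beta> l a b)
  case 0
  have e: "e = 1" "par e = 0" using 0 par_less[of 1] by auto
  have b: "\<beta> z \<le> 1" for z
  proof -
    have "\<beta> z \<le> l / N" "real l / N \<le> 1" using 0 N_pos by (auto simp: admissible_def)
    then show ?thesis by linarith
  qed
  have nn: "0 \<le> (\<Prod>z\<in>V - U - {a, b}. 1 - \<beta> z)" using b by (intro prod_nonneg) auto
  \<comment> \<open>Each arc starts with mass 1 and all weights 1, and only the arc
    \<open>(a, b)\<close> passes the test.\<close>
  have "mass 0 (test (0 + 2) e a b U \<beta> l) \<le>
     (\<Sum>p\<in>arcs1. if p = (a, b) then \<Prod>z\<in>V - U - {a, b}. 1 - \<beta> z else 0)"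
  proof (unfold mass.simps, rule sum_mono)
    fix p assume "p \<in> arcs1"
    obtain a' b' where p: "p = (a', b')" by (cases p)
    have im: "(\<lambda>i. if i = 0 then a' else b') ` {..<0 + 2::nat} = {a', b'}"
      by (auto simp: lessThan_Suc numeral_2_eq_2)
    have "(\<Prod>z\<in>V - {a, b}. if z \<in> U then 1 / 1 else 1 - \<beta> z / 1) = (\<Prod>z\<in>V - U - {a, b}. 1 - \<beta> z)"
      using finV by (intro prod.mono_neutral_cong_right) auto
    then show "(case p of (a', b') \<Rightarrow> test (0 + 2) e a b U \<beta> l (\<lambda>i. if i = 0 then a' else b', \<lambda>_ _. 1, N)) \<le>
      (if p = (a, b) then \<Prod>z\<in>V - U - {a, b}. 1 - \<beta> z else 0)"
      using e nn im unfolding p by (simp only: test.simps prod.case) auto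
  qed
  also have "\<dots> \<le> (\<Prod>z\<in>V - U - {a, b}. 1 - \<beta> z)" using nn by (subst sum.delta) auto
  finally show ?case .
next
  case (Suc i)
  let ?k = "i + 2"
  show ?case
  proof (cases "e \<le> i + 1")
    case True
    have "mass (Suc i) (test (Suc i + 2) e a b U \<beta> l) \<le> mass i (test ?k e a b U \<beta> l)"
      unfolding mass.simps using True Suc.prems by (intro mass_mono) (use test_step_old in auto)
    also have "\<dots> \<le> (\<Prod>z\<in>V - U - {a, b}. 1 - \<beta> z)"
      by (rule Suc.IH) (use Suc.prems True in auto)
    finally show ?thesis .
  next
    case False
    then have e: "e = ?k" using Suc.prems by auto
    have b: "\<beta> z \<le> 1" for z
    proof -
      have "\<beta> z \<le> l / N" "real l / N \<le> 1" using Suc.prems N_pos by (auto simp: admissible_def)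
      then show ?thesis by linarith
    qed
    show ?thesis
    \<comment> \<open>At an impossible position \<open>test\<close> vanishes; any other position
      meets the assumptions of \<open>telescoping_targets_le\<close>.\<close>
    proof (cases "a \<in> U \<or> b \<in> U \<or> b \<notin> nb (dir e) a")
      case True
      have "mass (Suc i) (test (Suc i + 2) e a b U \<beta> l) \<le> mass (Suc i) (\<lambda>_. 0)"
        by (rule mass_mono) (use test_eq_0[OF _ _ True] e in auto)
      also have "\<dots> = 0" using mass_cmult[where c = 0 and F = "\<lambda>_. 0"] by simp
      also have "\<dots> \<le> (\<Prod>z\<in>V - U - {a, b}. 1 - \<beta> z)" using b by (intro prod_nonneg) auto
      finally show ?thesis .
    next
      case False
      let ?Y = "others ?k a b - U - {b}"
      let ?F = "\<lambda>y. others ?k a b - {y}" and ?G = "targets ?k a b"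
      let ?I = "{r. r \<in> {1..<N} \<and> l + r \<le> N}"
      let ?C = "\<lambda>r y. 1 / N * (\<Prod>z\<in>U. gain r (?F y) (?G y) z)"
      let ?t = "\<lambda>r y. test ?k (ref (par ?k)) (if par ?k = 0 then a else y) (if par ?k = 0 then y else a)
        (insert b U) (shift r (?F y) (?G y) \<beta>) (l + r)"
      have bV: "b \<in> V" using False nb_V by blast
      have fin: "finite ?Y" "finite ?I" by (auto simp: others_def)
      have "mass (Suc i) (test (Suc i + 2) e a b U \<beta> l) \<le> mass i (\<lambda>x. \<Sum>r\<in>?I. \<Sum>y\<in>?Y. ?C r y * ?t r y x)"
        unfolding mass.simps e using test_step_new[of ?k] Suc.prems by (intro mass_mono) auto
      also have "\<dots> = (\<Sum>r\<in>?I. \<Sum>y\<in>?Y. ?C r y * mass i (?t r y))"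
        by (simp only: mass_sum[OF fin(1)] mass_sum[OF fin(2)] mass_cmult)
      also have "\<dots> \<le> (\<Sum>r\<in>?I. \<Sum>y\<in>?Y. ?C r y * (\<Prod>z\<in>V - insert b U - {a, y}. 1 - shift r (?F y) (?G y) \<beta> z))"
      proof (intro sum_mono mult_left_mono)
        fix r y assume r: "r \<in> ?I"
        have "mass i (?t r y) \<le> (\<Prod>z\<in>V - insert b U - {if par ?k = 0 then a else y, if par ?k = 0 then y else a}.
            1 - shift r (?F y) (?G y) \<beta> z)"
          using ref_bounds[of ?k] Suc.prems bV r by (intro Suc.IH admissible_shift) auto
        also have "{if par ?k = 0 then a else y, if par ?k = 0 then y else a} = {a, y}" by auto
        finally show "mass i (?t r y) \<le> (\<Prod>z\<in>V - insert b U - {a, y}. 1 - shift r (?F y) (?G y) \<beta> z)" .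
        show "0 \<le> ?C r y" using r by (intro mult_nonneg_nonneg prod_nonneg ballI) (auto simp: gain_def)
      qed
      also have "\<dots> \<le> (\<Prod>z\<in>V - U - {a, b}. 1 - \<beta> z)"
        by (rule telescoping_targets_le) (use False e Suc.prems in auto)
      finally show ?thesis .
    qed
  qed
qed

section \<open>Waiting times and the budget\<close>

lemma admissible_0: "admissible (\<lambda>_. 0) 0" by (simp add: admissible_def)

lemma card_arcs1: "card arcs1 = (\<Sum>v\<in>V. card (nb d v))"
proof -
  have "arcs1 = Sigma V (nb (dir 1))" using nb_V by (auto simp: arcs1_def)
  then have "card arcs1 = (\<Sum>v\<in>V. card (nb (dir 1) v))" using finV by simp
  also have "\<dots> = (\<Sum>v\<in>V. card (nb d v))" by (rule sum.cong[OF refl card_nb])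
  finally show ?thesis .
qed

text \<open>Split by the position of edge 1: there are \<open>card arcs1\<close> positions, each of
  mass at most 1.\<close>

lemma mass_one_le: "mass i (\<lambda>_. 1) \<le> card arcs1"
proof -
  have "mass i (\<lambda>_. 1) \<le> mass i (\<lambda>x. \<Sum>(a, b)\<in>arcs1. test (i + 2) 1 a b {} (\<lambda>_. 0) 0 x)"
  proof (rule mass_mono)
    fix x assume val: "valid (i + 2) x"
    obtain \<phi> \<rho> R where x: "x = (\<phi>, \<rho>, R)" by (cases x)
    have "\<phi> 1 \<in> nb (dir 1) (\<phi> (par 1))" using val by (simp add: x)
    then have mem: "(\<phi> (par 1), \<phi> 1) \<in> arcs1" by (simp add: arcs1_def)
    have nn: "0 \<le> (case p of (a, b) \<Rightarrow> test (i + 2) 1 a b {} (\<lambda>_. 0) 0 x)" for p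
      using test_nonneg[OF val _ admissible_0, of 1] by (cases p) auto
    have "1 = test (i + 2) 1 (\<phi> (par 1)) (\<phi> 1) {} (\<lambda>_. 0) 0 x" by (simp add: x)
    also have "\<dots> \<le> (\<Sum>(a, b)\<in>arcs1. test (i + 2) 1 a b {} (\<lambda>_. 0) 0 x)"
      using member_le_sum[OF mem _ finite_arcs1, of "\<lambda>(a, b). test (i + 2) 1 a b {} (\<lambda>_. 0) 0 x"] nn by auto
    finally show "1 \<le> (\<Sum>(a, b)\<in>arcs1. test (i + 2) 1 a b {} (\<lambda>_. 0) 0 x)" .
  qed
  also have "\<dots> = (\<Sum>(a, b)\<in>arcs1. mass i (test (i + 2) 1 a b {} (\<lambda>_. 0) 0))"
    by (simp add: mass_sum[OF finite_arcs1] split_beta)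
  also have "\<dots> \<le> (\<Sum>(a, b)\<in>arcs1. 1)"
    using mass_test_le[of 1 i "{}" "\<lambda>_. 0" 0] admissible_0 by (intro sum_mono) auto
  finally show ?thesis by simp
qed

text \<open>Tail-sum form of the expected time until the first ring, cut off at the budget.\<close>

fun wait :: "nat \<Rightarrow> 'a state \<Rightarrow> real" where
  "wait k (\<phi>, \<rho>, R) = (\<Sum>r<R. \<Prod>b\<in>scan k \<phi>. surv k \<rho> r b)"

text \<open>Given the position \<open>(v, y)\<close> of the reference edge, the chance of silence up
  to \<open>r\<close> is itself a \<open>test\<close>, with \<open>\<beta> = r / N\<close> on D - 1
  candidates, where D is the degree of \<open>v\<close>. Its mass is at most (1 - r/N)^(D-1);
  summing over \<open>r\<close> and the D choices of \<open>y\<close> gives N + D by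
  \<open>sum_power_ramp_le\<close>.\<close>

lemma mass_wait_le: "mass i (wait (i + 2)) \<le> card V * N + card arcs1"
proof -
  let ?k = "i + 2"
  let ?p = "par ?k"
  let ?e = "ref ?p"
  define B where "B v y r z = (if z \<in> nb (dir ?k) v - {twin (rdir ?p) (dir ?k) v y} then real r / N else 0)" for v y r z
  let ?t = "\<lambda>v y r. test ?k ?e (if ?p = 0 then v else y) (if ?p = 0 then y else v) {} (B v y r) r"
  have e: "?e \<in> {1..<?k}" "?e \<in> {1..i + 1}" using ref_bounds[of ?k] by auto
  have adm: "admissible (B v y r) r" if "r < N" for v y r
    using that by (auto simp: admissible_def B_def)
  have "mass i (wait ?k) \<le> mass i (\<lambda>x. \<Sum>v\<in>V. \<Sum>y\<in>nb (rdir ?p) v. \<Sum>r<N. ?t v y r x)"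
  proof (rule mass_mono)
    fix x assume val: "valid ?k x"
    obtain \<phi> \<rho> R where x: "x = (\<phi>, \<rho>, R)" by (cases x)
    have val': "valid ?k (\<phi>, \<rho>, R)" using val x by simp
    define v where "v = \<phi> ?p"
    define y where "y = \<phi> (oth ?p)"
    have nn: "0 \<le> ?t v y r x" if "r < N" for v y r
      by (rule test_nonneg[OF val e(1) adm[OF that]])
    have y: "y \<in> nb (rdir ?p) v" using valid_oth[OF val'] by (simp add: y_def v_def)
    then have v: "v \<in> V" using nb_V by blast
    have R: "R \<le> N" using val' by simp
    have "wait ?k x \<le> (\<Sum>r<R. ?t v y r x)"
    proof -
      have "(\<Prod>b\<in>scan ?k \<phi>. surv ?k \<rho> r b) = ?t v y r x" if "r < R" for r
      proof -
        have "(\<Prod>b\<in>scan ?k \<phi>. surv ?k \<rho> r b) = (\<Prod>z\<in>V - \<phi> ` {..<?k}. 1 - B v y r z / \<rho> ?e z)"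
        proof (rule prod.mono_neutral_cong_left)
          show "scan ?k \<phi> \<subseteq> V - \<phi> ` {..<?k}" using scan_subset by (auto simp: scan_def)
        qed (use finV in \<open>auto simp: scan_def B_def surv_def v_def y_def tw_def\<close>)
        moreover have "\<phi> (par ?e) = (if ?p = 0 then v else y)" "\<phi> ?e = (if ?p = 0 then y else v)"
          using par_less[of 1] by (auto simp: v_def y_def ref_def oth_def)
        ultimately show ?thesis using that unfolding x by (simp only: test.simps) auto
      qed
      then show ?thesis by (simp add: x)
    qed
    also have "\<dots> \<le> (\<Sum>r<N. ?t v y r x)" by (rule sum_mono2) (use R nn in auto)
    also have "\<dots> \<le> (\<Sum>y\<in>nb (rdir ?p) v. \<Sum>r<N. ?t v y r x)"
      by (rule member_le_sum[OF y, of "\<lambda>y. \<Sum>r<N. ?t v y r x"]) (use nn in \<open>auto intro!: sum_nonneg\<close>)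
    also have "\<dots> \<le> (\<Sum>v\<in>V. \<Sum>y\<in>nb (rdir ?p) v. \<Sum>r<N. ?t v y r x)"
      by (rule member_le_sum[OF v, of "\<lambda>v. \<Sum>y\<in>nb (rdir ?p) v. \<Sum>r<N. ?t v y r x"])
        (use nn finV in \<open>auto intro!: sum_nonneg\<close>)
    finally show "wait ?k x \<le> (\<Sum>v\<in>V. \<Sum>y\<in>nb (rdir ?p) v. \<Sum>r<N. ?t v y r x)" .
  qed
  also have "\<dots> = (\<Sum>v\<in>V. \<Sum>y\<in>nb (rdir ?p) v. \<Sum>r<N. mass i (?t v y r))"
    by (simp only: mass_sum[OF finV] mass_sum[OF finite_nb] mass_sum[OF finite_lessThan])
  also have "\<dots> \<le> (\<Sum>v\<in>V. \<Sum>y\<in>nb (rdir ?p) v. \<Sum>r<N. (1 - real r / N) ^ (card (nb (rdir ?p) v) - 1))"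
  proof (intro sum_mono)
    fix v y r assume y: "y \<in> nb (rdir ?p) v" and r: "r \<in> {..<N}"
    let ?\<theta> = "twin (rdir ?p) (dir ?k) v"
    have "?\<theta> y \<in> nb (dir ?k) v" by (rule bij_betw_apply[OF twin(1) y])
    then have card: "card (nb (dir ?k) v - {?\<theta> y}) = card (nb (rdir ?p) v) - 1"
      by (metis card_Diff_singleton card_nb)
    have sub: "nb (dir ?k) v - {?\<theta> y} \<subseteq> V - {v, y}"
      using nb_subset twin(2)[OF y, of "dir ?k"] by auto
    have "mass i (?t v y r) \<le> (\<Prod>z\<in>V - {} - {if ?p = 0 then v else y, if ?p = 0 then y else v}. 1 - B v y r z)"
      by (rule mass_test_le[OF e(2) _ adm]) (use r in auto)
    also have "V - {} - {if ?p = 0 then v else y, if ?p = 0 then y else v} = V - {v, y}" by auto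
    also have "(\<Prod>z\<in>V - {v, y}. 1 - B v y r z) = (\<Prod>z\<in>nb (dir ?k) v - {?\<theta> y}. 1 - real r / N)"
      by (rule prod.mono_neutral_cong_right) (use finV sub in \<open>auto simp: B_def\<close>)
    also have "\<dots> = (1 - real r / N) ^ (card (nb (rdir ?p) v) - 1)" by (simp only: prod_constant card)
    finally show "mass i (?t v y r) \<le> (1 - real r / N) ^ (card (nb (rdir ?p) v) - 1)" .
  qed
  also have "\<dots> \<le> (\<Sum>v\<in>V. real (N + card (nb (rdir ?p) v)))"
    using sum_power_ramp_le[OF N_pos] by (intro sum_mono) simp
  also have "\<dots> = card V * N + card arcs1"
    by (simp add: card_arcs1[of "rdir ?p"] sum.distrib)
  finally show ?thesis .
qed

text \<open>If \<open>P r\<close> is the chance of silence up to \<open>r\<close>, then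
  \<open>R - wait\<close> is the sum of the \<open>1 - P r\<close>, and a union bound makes each
  drop of \<open>P\<close> at most the ring density \<open>Q r\<close>. Exchanging sums weights
  \<open>Q s\<close> by at most \<open>R - s\<close>, the budget left after a ring at time
  \<open>s\<close>.\<close>

lemma budget_le:
  assumes "valid k x" and k: "2 \<le> k"
  shows "real (snd (snd x)) \<le> wait k x + step k (\<lambda>y. real (snd (snd y))) x + card V"
proof -
  obtain \<phi> \<rho> R where x: "x = (\<phi>, \<rho>, R)" by (cases x)
  have val: "valid k (\<phi>, \<rho>, R)" using assms x by simp
  define W where "W = scan k \<phi>"
  define \<delta> where "\<delta> w = 1 / (real N * \<rho> (ref (par k)) w)" for w
  define P where "P r = (\<Prod>b\<in>W. surv k \<rho> r b)" for r
  define Q where "Q r = (\<Sum>w\<in>W. \<delta> w * (\<Prod>b\<in>W - {w}. surv k \<rho> r b))" for r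
  have R: "1 \<le> R" "R \<le> N" using val by auto
  have fin: "finite W" and WV: "W \<subseteq> V" using scan_subset by (auto simp: W_def)
  have s0: "0 \<le> surv k \<rho> r b" if "b \<in> W" "r \<le> R" for r b
  proof -
    have "0 \<le> 1 - real r / R" using that R by auto
    then show ?thesis using surv_bounds(1)[OF val k that(2), of b] that WV by auto
  qed
  have \<delta>: "0 \<le> \<delta> w" "\<delta> w \<le> 1 / R" if "w \<in> W" for w
  proof -
    have "real R \<le> real N * \<rho> (ref (par k)) w" using val ref_bounds[OF k] that WV by auto
    moreover have "0 < real R" using R by simp
    ultimately show "0 \<le> \<delta> w" "\<delta> w \<le> 1 / R" unfolding \<delta>_def by (auto intro!: frac_le)
  qed
  have Q_nn: "0 \<le> Q r" if "r \<le> R" for r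
    unfolding Q_def using s0 \<delta> that by (intro sum_nonneg mult_nonneg_nonneg prod_nonneg) auto
  have dec: "P r - P (Suc r) \<le> Q r" if "r < R" for r
  proof -
    have diff: "surv k \<rho> r b - surv k \<rho> (Suc r) b = \<delta> b" for b
      by (simp add: surv_def \<delta>_def add_divide_distrib)
    have "P r - P (Suc r) \<le> (\<Sum>w\<in>W. (surv k \<rho> r w - surv k \<rho> (Suc r) w) * (\<Prod>b\<in>W - {w}. surv k \<rho> r b))"
      unfolding P_def
    proof (rule prod_diff_le_sum[OF fin])
      fix z assume "z \<in> W"
      then show "0 \<le> surv k \<rho> (Suc r) z \<and> surv k \<rho> (Suc r) z \<le> surv k \<rho> r z"
        using s0[of z "Suc r"] \<delta>(1)[of z] diff[of z] that by auto
    qed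
    then show ?thesis by (simp add: diff Q_def)
  qed
  have "P 0 = 1" by (simp add: P_def surv_def)
  have "1 - P r \<le> (\<Sum>s<r. Q s)" if "r \<le> R" for r
    using that
  proof (induction r)
    case (Suc r)
    then show ?case using dec[of r] by simp
  qed (simp add: \<open>P 0 = 1\<close>)
  then have "(\<Sum>r<R. 1 - P r) \<le> (\<Sum>r<R. \<Sum>s<r. Q s)" by (intro sum_mono) auto
  also have "\<dots> = (\<Sum>s<R. (real R - 1 - real s) * Q s)"
  proof (induction R)
    case (Suc R)
    have "(\<Sum>s<R. (real R - real s) * Q s) = (\<Sum>s<R. (real R - 1 - real s) * Q s) + (\<Sum>s<R. Q s)"
      by (simp add: sum.distrib[symmetric] algebra_simps)
    then show ?case using Suc by simp
  qed simp
  also have "\<dots> \<le> (\<Sum>s<R. (real R - real s) * Q s)"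
    using Q_nn by (intro sum_mono mult_right_mono) auto
  also have "\<dots> = real R * Q 0 + (\<Sum>s\<in>{1..<R}. (real R - real s) * Q s)"
    using sum.atLeast_Suc_lessThan[of 0 R "\<lambda>s. (real R - real s) * Q s"] R
    by (simp add: lessThan_atLeast0)
  \<comment> \<open>\<open>step\<close> starts at time 1, so the term of time 0 is paid for
    separately: each watched vertex has density at most \<open>1 / R\<close>.\<close>
  also have "real R * Q 0 \<le> card V"
  proof -
    have "Q 0 = (\<Sum>w\<in>W. \<delta> w)" by (simp add: Q_def surv_def)
    also have "\<dots> \<le> (\<Sum>w\<in>W. 1 / R)" using \<delta> by (intro sum_mono) auto
    finally have "real R * Q 0 \<le> card W" using R by (simp add: field_simps)
    then show ?thesis using card_mono[OF finV WV] by linarith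
  qed
  also have "(\<Sum>s\<in>{1..<R}. (real R - real s) * Q s) = step k (\<lambda>y. real (snd (snd y))) x"
    unfolding x step.simps Q_def W_def[symmetric] \<delta>_def[symmetric] sum_distrib_left
    by (subst sum.swap) (auto intro!: sum.cong simp: of_nat_diff mult_ac)
  also have "(\<Sum>r<R. 1 - P r) = real R - wait k x"
    by (simp add: x P_def W_def sum_subtractf)
  finally show ?thesis by (simp add: x)
qed

lemma mass_budget_le:
  "mass i (\<lambda>x. real (snd (snd x))) \<le>
     mass (Suc i) (\<lambda>x. real (snd (snd x))) + (card V * N + card arcs1 + card V * card arcs1)"
proof -
  have "mass i (\<lambda>x. real (snd (snd x))) \<le>
      mass i (\<lambda>x. wait (i + 2) x + step (i + 2) (\<lambda>y. real (snd (snd y))) x + real (card V) * 1)"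
    using budget_le by (intro mass_mono) auto
  also have "\<dots> = mass i (wait (i + 2)) + mass (Suc i) (\<lambda>x. real (snd (snd x))) + card V * mass i (\<lambda>_. 1)"
    by (simp only: mass_add mass_cmult mass.simps)
  also have "card V * mass i (\<lambda>_. 1) \<le> real (card V) * card arcs1"
    using mass_one_le by (intro mult_left_mono) auto
  finally show ?thesis using mass_wait_le[of i] by simp
qed

lemma ex_valid:
  assumes "(t - 1) * card V < card arcs1"
    and N: "(t - 1) * (card arcs1 + card V * card arcs1) < N" and "1 \<le> t"
  shows "\<exists>x. valid (t + 1) x"
proof (rule ccontr)
  assume neg: "\<not> (\<exists>x. valid (t + 1) x)"
  let ?R = "\<lambda>x :: 'a state. real (snd (snd x))"
  have "mass (t - 1) ?R \<le> mass (t - 1) (\<lambda>_. 0)"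
  proof (rule mass_mono)
    fix x assume "valid (t - 1 + 2) x"
    moreover have "t - 1 + 2 = t + 1" using \<open>1 \<le> t\<close> by simp
    ultimately show "?R x \<le> 0" using neg by metis
  qed
  also have "\<dots> = 0" using mass_cmult[where c = 0 and F = "\<lambda>_. 0"] by simp
  finally have "mass (t - 1) ?R \<le> 0" .
  moreover have budget: "mass 0 ?R \<le> mass i ?R + i * (card V * N + card arcs1 + card V * card arcs1)" for i
  proof (induction i)
    case (Suc i)
    then show ?case using mass_budget_le[of i] by (simp add: algebra_simps)
  qed simp
  ultimately have le: "mass 0 ?R \<le> real (t - 1) * (card V * N + card arcs1 + card V * card arcs1)"
    by (intro order_trans[OF budget[of "t - 1"]]) simp
  moreover have "mass 0 ?R = real (card arcs1 * N)" by (simp add: split_beta)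
  then have "card arcs1 * N \<le> (t - 1) * (card V * N + card arcs1 + card V * card arcs1)"
    using le by (metis of_nat_le_iff of_nat_mult)
  \<comment> \<open>By integrality the strict inequality leaves a surplus of a full
    \<open>N\<close>, which outweighs the error terms.\<close>
  moreover have "((t - 1) * card V + 1) * N \<le> card arcs1 * N"
    using assms(1) by (intro mult_right_mono) auto
  ultimately have "N \<le> (t - 1) * (card arcs1 + card V * card arcs1)" by (simp add: algebra_simps)
  then show False using N by simp
qed

end

lemma ex_tree_embedding:
  fixes V :: "'a set" and E :: "'a \<Rightarrow> 'a \<Rightarrow> bool"
  assumes "finite V" "\<And>u v. E u v \<Longrightarrow> u \<in> V \<and> v \<in> V" "\<And>v. \<not> E v v"
    and balanced: "\<And>v. card {u. E v u} = card {u. E u v}"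
    and par: "\<And>k. 0 < k \<Longrightarrow> par k < k"
    and large: "(t - 1) * card V < card {(u, v). E u v}" and "1 \<le> t"
  obtains \<phi> :: "nat \<Rightarrow> 'a" where "inj_on \<phi> {..t}" "\<phi> ` {..t} \<subseteq> V"
    "\<And>k. k \<in> {1..t} \<Longrightarrow> if dir k then E (\<phi> (par k)) (\<phi> k) else E (\<phi> k) (\<phi> (par k))"
proof -
  let ?m = "card {(u, v). E u v}"
  \<comment> \<open>The last argument is \<open>N\<close>: one more than the total error of
    \<open>t - 1\<close> rounds, as \<open>ex_valid\<close> requires.\<close>
  interpret scanning V E par dir "(t - 1) * (?m + card V * ?m) + 1"
    by unfold_locales (use assms in auto)
  have "card arcs1 = (\<Sum>v\<in>V. card (nb True v))" by (rule card_arcs1)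
  also have "\<dots> = card (Sigma V (nb True))" using finV by simp
  also have "Sigma V (nb True) = {(u, v). E u v}" using E_V by (auto simp: nb_def)
  finally have m: "card arcs1 = ?m" .
  have "\<exists>x. valid (t + 1) x"
    by (rule ex_valid) (use large \<open>1 \<le> t\<close> in \<open>auto simp: m\<close>)
  then obtain \<phi> \<rho> R where "valid (t + 1) (\<phi>, \<rho>, R)" by auto
  moreover have "{..<t + 1} = {..t}" "{1..<t + 1} = {1..t}" by auto
  ultimately have \<phi>: "inj_on \<phi> {..t}" "\<phi> ` {..t} \<subseteq> V" "\<forall>k\<in>{1..t}. \<phi> k \<in> nb (dir k) (\<phi> (par k))"
    by (auto simp only: valid.simps)
  show thesis
    by (rule that[OF \<phi>(1,2)]) (use \<phi>(3) in \<open>auto simp: nb_def split: if_splits\<close>)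
qed

section \<open>Enumerating an oriented tree\<close>

lemma (in wf_digraph) crossing_arc:
  assumes "u \<rightarrow>\<^sup>* v" "u \<in> S" "v \<notin> S"
  shows "\<exists>e\<in>arcs G. tail G e \<in> S \<and> head G e \<notin> S"
  using assms by (induction rule: reachable_induct) (auto elim!: reachableE)

text \<open>Connectivity gives an arc leaving the enumerated set, and its head comes next. The paths
  inside the enumerated set are carried along to show that this head has only one earlier neighbour:
  a second one would close a cycle.\<close>

lemma undirected_tree_enumeration:
  fixes U :: "('a, 'b) pre_digraph"
  assumes tree: "undirected_tree U" and "s < card (verts U)"
  shows "\<exists>x par. inj_on x {..s} \<and> x ` {..s} \<subseteq> verts U \<and>
    (\<forall>i\<in>{1..s}. par i < i \<and> (\<forall>j<i. x j \<rightarrow>\<^bsub>U\<^esub> x i \<longleftrightarrow> j = par i)) \<and>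
    (\<forall>a\<in>x ` {..s}. \<forall>b\<in>x ` {..s}. \<exists>p. pre_digraph.apath U a p b \<and>
       set (pre_digraph.awalk_verts U a p) \<subseteq> x ` {..s})"
  using assms(2)
proof (induction s)
  interpret graph U using tree by (simp add: undirected_tree_def)
  case 0
  then obtain v where v: "v \<in> verts U" by fastforce
  show ?case
    by (rule exI[of _ "\<lambda>_. v"]) (use v in \<open>auto simp: apath_Nil_iff intro!: exI[of _ "[]"]\<close>)
next
  interpret graph U using tree by (simp add: undirected_tree_def)
  case (Suc s)
  then obtain x par where inj: "inj_on x {..s}" and sub: "x ` {..s} \<subseteq> verts U"
    and par: "\<forall>i\<in>{1..s}. par i < i \<and> (\<forall>j<i. x j \<rightarrow>\<^bsub>U\<^esub> x i \<longleftrightarrow> j = par i)"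
    and path: "\<forall>a\<in>x ` {..s}. \<forall>b\<in>x ` {..s}. \<exists>p. apath a p b \<and> set (awalk_verts a p) \<subseteq> x ` {..s}"
    using Suc.IH[OF Suc_lessD[OF Suc.prems]] by (elim exE conjE) (rule that)
  have "card (x ` {..s}) = Suc s" using inj by (simp add: card_image)
  then have "x ` {..s} \<noteq> verts U" using Suc.prems by auto
  then obtain w where w: "w \<in> verts U" "w \<notin> x ` {..s}" using sub by blast
  have "x 0 \<rightarrow>\<^sup>*\<^bsub>U\<^esub> w"
  proof -
    have "x 0 \<rightarrow>\<^sup>*\<^bsub>with_proj (mk_symmetric U)\<^esub> w"
      using tree w sub by (auto simp: undirected_tree_def connected_def strongly_connected_def)
    then show ?thesis using reachable_mk_symmetric_eq[OF sym_arcs] by simp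
  qed
  then obtain e where e: "e \<in> arcs U" "tail U e \<in> x ` {..s}" "head U e \<notin> x ` {..s}"
    using crossing_arc[of "x 0" w "x ` {..s}"] w by auto
  define v where "v = head U e"
  obtain k where k: "k \<le> s" "tail U e = x k" using e by auto
  have v: "v \<in> verts U" "v \<notin> x ` {..s}" using e by (auto simp: v_def)
  have kv: "x k \<rightarrow>\<^bsub>U\<^esub> v" using in_arcs_imp_in_arcs_ends[OF e(1)] k by (simp add: v_def)
  then obtain e' where e': "e' \<in> arcs U" "tail U e' = v" "head U e' = x k"
    using arcs_ends_symmetric[OF sym_arcs kv] by (auto elim: reachableE)
  have uniq: "j = k" if j: "j \<le> s" "x j \<rightarrow>\<^bsub>U\<^esub> v" for j
  proof (rule ccontr)
    assume "j \<noteq> k"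
    \<comment> \<open>Leaving \<open>v\<close> by \<open>f\<close>, following \<open>q\<close> and
      returning by \<open>e\<close> is a cycle; \<open>j \<noteq> k\<close> makes \<open>q\<close>
      nonempty, so its length is at least 3.\<close>
    obtain f where f: "f \<in> arcs U" "tail U f = v" "head U f = x j"
      using arcs_ends_symmetric[OF sym_arcs j(2)] by (auto elim: reachableE)
    obtain q where q: "apath (x j) q (x k)" "set (awalk_verts (x j) q) \<subseteq> x ` {..s}"
      using path j k by blast
    have "q \<noteq> []" using q inj that k \<open>j \<noteq> k\<close> by (auto simp: apath_Nil_iff dest: inj_onD)
    have last: "awlast (x j) q = x k" using q by (auto simp: apath_def)
    have w: "awalk (x j) (q @ [e]) v"
      using q e k by (auto simp: last apath_def awalk_Cons_iff awalk_Nil_iff v_def)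
    have "awalk_verts (x j) (q @ [e]) = awalk_verts (x j) q @ [v]"
      using awalk_verts_append[OF w] by (simp add: last v_def)
    then have "distinct (tl (awalk_verts v (f # q @ [e])))"
      using q v f by (auto simp: apath_def)
    moreover have "awalk v (f # q @ [e]) v" using w f by (auto simp: awalk_Cons_iff)
    ultimately have "cycle (f # q @ [e])" by (auto simp: cycle_def)
    moreover have "3 \<le> length (f # q @ [e])" using \<open>q \<noteq> []\<close> by (cases q) auto
    ultimately show False using tree by (auto simp: undirected_tree_def)
  qed
  let ?x = "x(Suc s := v)" and ?par = "par(Suc s := k)"
  have img: "?x ` {..Suc s} = insert v (x ` {..s})" by (auto simp: atMost_Suc)
  have "inj_on ?x {..Suc s}" using inj v by (auto simp: atMost_Suc inj_on_def)
  moreover have "?x ` {..Suc s} \<subseteq> verts U" using img sub v by auto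
  moreover have "?par i < i \<and> (\<forall>j<i. ?x j \<rightarrow>\<^bsub>U\<^esub> ?x i \<longleftrightarrow> j = ?par i)" if "i \<in> {1..Suc s}" for i
  proof (cases "i = Suc s")
    case True
    have "x j \<rightarrow>\<^bsub>U\<^esub> v \<longleftrightarrow> j = k" if "j \<le> s" for j using uniq kv that by blast
    then show ?thesis using True k(1) by (simp add: less_Suc_eq_le)
  next
    case False
    then have "i \<in> {1..s}" using that by auto
    moreover from this have "par i < i" using par by blast
    ultimately show ?thesis using par by simp
  qed
  moreover have "\<exists>p. apath a p b \<and> set (awalk_verts a p) \<subseteq> ?x ` {..Suc s}"
    if a: "a \<in> ?x ` {..Suc s}" and b: "b \<in> ?x ` {..Suc s}" for a b
  proof -
    have xk: "x k \<in> x ` {..s}" using k by auto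
    consider "a = v" "b = v" | "a = v" "b \<in> x ` {..s}" | "a \<in> x ` {..s}" "b = v"
      | "a \<in> x ` {..s}" "b \<in> x ` {..s}"
      using a b img by auto
    then show ?thesis
    proof cases
      case 1
      then show ?thesis using v unfolding img by (intro exI[of _ "[]"]) (auto simp: apath_Nil_iff)
    next
      case 2
      then obtain p where "apath (x k) p b" "set (awalk_verts (x k) p) \<subseteq> x ` {..s}" using path xk by blast
      then show ?thesis using 2 e' v unfolding img
        by (intro exI[of _ "e' # p"]) (auto simp: apath_Cons_iff)
    next
      case 3
      then obtain p where p: "apath a p (x k)" "set (awalk_verts a p) \<subseteq> x ` {..s}" using path xk by blast
      have last: "awlast a p = x k" using p by (auto simp: apath_def)
      have p': "apath a (p @ [e]) v"
        unfolding apath_append_iff last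
        using p e k v xk no_loops[OF e(1)] by (auto simp: apath_Cons_iff apath_Nil_iff v_def)
      then have "awalk_verts a (p @ [e]) = awalk_verts a p @ [v]"
        using awalk_verts_append[of a p "[e]" v] by (simp add: last v_def apath_def)
      then show ?thesis using 3 p p' unfolding img by (intro exI[of _ "p @ [e]"]) auto
    next
      case 4
      then show ?thesis using path unfolding img by blast
    qed
  qed
  ultimately show ?case by (intro exI[of _ ?x] exI[of _ ?par]) blast
qed

lemma oriented_tree_enumeration:
  assumes "oriented_tree T"
  obtains x and par :: "nat \<Rightarrow> nat" and dir and s
  where "bij_betw x {..s} (verts T)" "s \<le> card (arcs T)" "\<And>i. 0 < i \<Longrightarrow> par i < i"
    "\<And>u v. u \<rightarrow>\<^bsub>T\<^esub> v \<Longrightarrow> \<exists>i\<in>{1..s}. if dir i then u = x (par i) \<and> v = x i else u = x i \<and> v = x (par i)"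
proof -
  obtain U :: "'a pair_pre_digraph" where tree: "undirected_tree (with_proj U)"
    and orient: "orientation_of T (with_proj U)"
    using assms by (auto simp: oriented_tree_def)
  let ?U = "with_proj U"
  interpret U: graph ?U using tree by (simp add: undirected_tree_def)
  interpret T: digraph T using orient by (simp add: orientation_of_def)
  have verts: "verts T = verts ?U" and sub: "arcs_ends T \<subseteq> arcs_ends ?U"
    and one: "\<And>u v. u \<rightarrow>\<^bsub>?U\<^esub> v \<Longrightarrow> (u \<rightarrow>\<^bsub>T\<^esub> v) \<noteq> (v \<rightarrow>\<^bsub>T\<^esub> u)"
    using orient by (auto simp: orientation_of_def)
  have "verts ?U \<noteq> {}" using tree by (auto simp: undirected_tree_def connected_def strongly_connected_def)
  then have "card (verts ?U) \<noteq> 0" using U.finite_verts by (metis card_0_eq)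
  define s where "s = card (verts ?U) - 1"
  have s: "s < card (verts ?U)" "card (verts ?U) = Suc s" using \<open>card (verts ?U) \<noteq> 0\<close> by (auto simp: s_def)
  obtain x p where inj: "inj_on x {..s}" and img: "x ` {..s} \<subseteq> verts ?U"
    and p: "\<forall>i\<in>{1..s}. p i < i \<and> (\<forall>j<i. x j \<rightarrow>\<^bsub>?U\<^esub> x i \<longleftrightarrow> j = p i)"
    using undirected_tree_enumeration[OF tree s(1)] by (elim exE conjE) (rule that)
  \<comment> \<open>The default 0 makes \<open>par i < i\<close> hold for every positive
    \<open>i\<close>, as the process demands; indices beyond \<open>s\<close> act as extra leaves at
    the root.\<close>
  define par where "par i = (if i \<in> {1..s} then p i else 0)" for i
  have par: "par i < i" if "0 < i" for i using that p by (auto simp: par_def)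
  have par_iff: "x j \<rightarrow>\<^bsub>?U\<^esub> x i \<longleftrightarrow> j = par i" if "i \<in> {1..s}" "j < i" for i j
    using that p by (auto simp: par_def)
  have surj: "x ` {..s} = verts ?U"
    using inj img s(2) U.finite_verts by (intro card_subset_eq) (auto simp: card_image)
  define dir where "dir i \<longleftrightarrow> x (par i) \<rightarrow>\<^bsub>T\<^esub> x i" for i
  have arc: "(if dir i then (x (par i), x i) else (x i, x (par i))) \<in> arcs_ends T" if "i \<in> {1..s}" for i
    using one[of "x (par i)" "x i"] par[of i] par_iff[OF that, of "par i"] that by (auto simp: dir_def)
  \<comment> \<open>As \<open>par i < i\<close>, the later end of the arc belonging to
    \<open>i\<close> is \<open>x i\<close>, so different \<open>i\<close> give different
    arcs.\<close>
  have "card {1..s} \<le> card (arcs_ends T)"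
  proof (rule card_inj_on_le[where f = "\<lambda>i. if dir i then (x (par i), x i) else (x i, x (par i))"])
    show "inj_on (\<lambda>i. if dir i then (x (par i), x i) else (x i, x (par i))) {1..s}"
    proof (rule inj_onI)
      fix i j assume ij: "i \<in> {1..s}" "j \<in> {1..s}" and
        eq: "(if dir i then (x (par i), x i) else (x i, x (par i))) = (if dir j then (x (par j), x j) else (x j, x (par j)))"
      have "x i = x j \<or> x i = x (par j) \<and> x (par i) = x j" using eq by (auto split: if_splits)
      moreover have "par i < i" "par j < j" using par ij by auto
      ultimately show "i = j" using inj ij
        by (smt (verit, ccfv_SIG) atLeastAtMost_iff atMost_iff inj_on_def le_trans less_imp_le_nat not_less_iff_gr_or_eq order_less_trans)
    qed
    show "(\<lambda>i. if dir i then (x (par i), x i) else (x i, x (par i))) ` {1..s} \<subseteq> arcs_ends T"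
      using arc by blast
  qed (simp add: arcs_ends_def)
  also have "card (arcs_ends T) = card (arcs T)"
    unfolding arcs_ends_def by (rule card_image) (rule T.inj_on_arc_to_ends)
  finally have "s \<le> card (arcs T)" by simp
  moreover have "\<exists>i\<in>{1..s}. if dir i then u = x (par i) \<and> v = x i else u = x i \<and> v = x (par i)"
    if uv: "u \<rightarrow>\<^bsub>T\<^esub> v" for u v
  proof -
    have "u \<in> verts T" "v \<in> verts T" "u \<noteq> v" using T.adj_in_verts[OF uv] T.adj_not_same uv by auto
    then obtain i j where ij: "i \<le> s" "j \<le> s" "u = x i" "v = x j" "i \<noteq> j"
      unfolding verts surj[symmetric] by auto
    have U: "u \<rightarrow>\<^bsub>?U\<^esub> v" "v \<rightarrow>\<^bsub>?U\<^esub> u"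
      using sub uv arcs_ends_symmetric[OF U.sym_arcs, of u v] by blast+
    consider "i < j" | "j < i" using ij by linarith
    then show ?thesis
    proof cases
      case 1
      then have "i = par j" using par_iff[of j i] U ij by auto
      then show ?thesis using 1 ij uv by (intro bexI[of _ j]) (auto simp: dir_def)
    next
      case 2
      then have "j = par i" using par_iff[of i j] U ij by auto
      then show ?thesis using 2 ij uv one[OF U(1)] by (intro bexI[of _ i]) (auto simp: dir_def)
    qed
  qed
  moreover have "bij_betw x {..s} (verts T)" using inj surj verts by (simp add: bij_betw_def)
  ultimately show thesis using par by (intro that[of x s par dir])
qed

section \<open>Transfer to digraphs and conclusion\<close>

lemma (in digraph) card_neighbors:
  "card {u. v \<rightarrow> u} = out_degree G v" "card {u. u \<rightarrow> v} = in_degree G v"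
proof -
  have "{u. v \<rightarrow> u} = head G ` out_arcs G v" "inj_on (head G) (out_arcs G v)"
    by (auto simp: arcs_ends_conv arc_to_ends_def inj_on_def intro!: no_multi_arcs)
  then show "card {u. v \<rightarrow> u} = out_degree G v" by (simp add: out_degree_def card_image)
  have "{u. u \<rightarrow> v} = tail G ` in_arcs G v" "inj_on (tail G) (in_arcs G v)"
    by (auto simp: arcs_ends_conv arc_to_ends_def inj_on_def intro!: no_multi_arcs)
  then show "card {u. u \<rightarrow> v} = in_degree G v" by (simp add: in_degree_def card_image)
qed

theorem theorem2p2:
  fixes G :: "('a, 'b) pre_digraph" and t n m :: nat
  assumes "t \<ge> 1"
    and "digraph G" and "eulerian G"
    and "n = card (verts G)" and "n \<ge> 1"
    and "m = card (arcs G)"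
    and "m > (t - 1) * n"
  shows "\<forall>T :: ('c, 'd) pre_digraph.
           oriented_tree T \<and> card (arcs T) = t \<longrightarrow> contains_copy G T"
proof (intro allI impI, elim conjE)
  fix T :: "('c, 'd) pre_digraph"
  assume T: "oriented_tree T" "card (arcs T) = t"
  interpret G: digraph G by fact
  obtain x s par dir where x: "bij_betw x {..s} (verts T)" and s: "s \<le> card (arcs T)"
    and par: "\<And>i. 0 < i \<Longrightarrow> par i < i"
    and arcs: "\<And>u v. u \<rightarrow>\<^bsub>T\<^esub> v \<Longrightarrow>
      \<exists>i\<in>{1..s}. if dir i then u = x (par i) \<and> v = x i else u = x i \<and> v = x (par i)"
    by (rule oriented_tree_enumeration[OF T(1)]) (rule that)
  have "card {(u, v). u \<rightarrow>\<^bsub>G\<^esub> v} = m"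
    using card_image[OF G.inj_on_arc_to_ends] assms(6) by (simp add: arcs_ends_def)
  then have large: "(t - 1) * card (verts G) < card {(u, v). u \<rightarrow>\<^bsub>G\<^esub> v}"
    using assms by simp
  have ends: "u \<in> verts G \<and> v \<in> verts G" if "u \<rightarrow>\<^bsub>G\<^esub> v" for u v
    using G.adj_in_verts[OF that] by simp
  have loopfree: "\<not> v \<rightarrow>\<^bsub>G\<^esub> v" for v using G.adj_not_same by blast
  have balanced: "card {u. v \<rightarrow>\<^bsub>G\<^esub> u} = card {u. u \<rightarrow>\<^bsub>G\<^esub> v}" for v
  proof (cases "v \<in> verts G")
    case True
    then show ?thesis using assms(3) by (simp add: G.card_neighbors eulerian_def)
  next
    case False
    then have "{u. v \<rightarrow>\<^bsub>G\<^esub> u} = {}" "{u. u \<rightarrow>\<^bsub>G\<^esub> v} = {}" using G.adj_in_verts by blast+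
    then show ?thesis by simp
  qed
  obtain \<phi> where \<phi>: "inj_on \<phi> {..t}" "\<phi> ` {..t} \<subseteq> verts G"
    and \<phi>_arc: "\<And>k. k \<in> {1..t} \<Longrightarrow>
      if dir k then \<phi> (par k) \<rightarrow>\<^bsub>G\<^esub> \<phi> k else \<phi> k \<rightarrow>\<^bsub>G\<^esub> \<phi> (par k)"
    by (rule ex_tree_embedding[where dir = dir,
        OF G.finite_verts ends loopfree balanced par large \<open>t \<ge> 1\<close>], assumption, assumption, rule that)
  \<comment> \<open>The embedding is indexed by \<open>0, ..., t\<close>; it is read off on the
    indices up to \<open>s \<le> t\<close> that enumerate \<open>T\<close>.\<close>
  define \<psi> where "\<psi> = \<phi> \<circ> inv_into {..s} x"
  have st: "{..s} \<subseteq> {..t}" using s T by auto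
  have \<psi>_x: "\<psi> (x i) = \<phi> i" if "i \<le> s" for i
    using x that by (simp add: \<psi>_def bij_betw_def inv_into_f_f)
  have verts: "verts T = x ` {..s}" using x by (simp add: bij_betw_def)
  show "contains_copy G T"
    unfolding contains_copy_def
  proof (intro exI[of _ \<psi>] conjI allI impI)
    show "inj_on \<psi> (verts T)"
      using inj_on_subset[OF \<phi>(1) st] by (auto simp: verts inj_on_def \<psi>_x)
    show "\<psi> ` verts T \<subseteq> verts G" using \<phi>(2) st by (auto simp: verts \<psi>_x)
    fix u v assume "u \<rightarrow>\<^bsub>T\<^esub> v"
    then obtain i where i: "i \<in> {1..s}"
      "if dir i then u = x (par i) \<and> v = x i else u = x i \<and> v = x (par i)"
      using arcs by blast
    moreover have "par i < i" using i par by simp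
    moreover have "i \<in> {1..t}" using i st by auto
    ultimately show "\<psi> u \<rightarrow>\<^bsub>G\<^esub> \<psi> v" using \<phi>_arc[of i] by (auto simp: \<psi>_x split: if_splits)
  qed
qed

end
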